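(* For every rational word $x$ there exist an integer $n\ge 0$, rational prime words $u_1 >_{lex} u_2 >_{lex} \cdots >_{lex} u_n$, and ordinals $\alpha_1,\dots,\alpha_n$ less than $\omega^\omega$ such that $x = u_1^{\alpha_1}\cdots u_n^{\alpha_n}$.
   Context: $A$ is a finite alphabet with a linear order $<_A$. A word is a sequence of letters indexed by a countable ordinal (its length); $x^\alpha$ denotes the concatenation of $\alpha$ copies of $x$. Write $x<_{str}x'$ if there are letters $a<_A b$ and words $y,z,z'$ with $x=yaz$, $x'=ybz'$; the lexicographic order is $x\le_{lex}x'$ iff $x$ is a prefix of $x'$ or $x<_{str}x'$. A word $x$ is primitive if $x=y^\alpha$ implies $\alpha=1$ and $y=x$. A word $w$ is prime if it is primitive and every proper suffix $z$ of $w$ (i.e. $z=w[\gamma,|w|)$ with $0<\gamma<|w|$) satisfies $w\le_{lex}z$. The class of rational words is the smallest class of words containing the empty word and the single letters and closed under concatenation $(u,v)\mapsto uv$ and $\omega$-iteration $u\mapsto u^\omega$. *)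

theory Defs
  imports Main "HOL-Library.Nat_Bijection"
begin

text \<open>A transfinite word over the alphabet 'a is represented by a pair (r, f):
  r is a well-order on a subset of nat (so its order type is a countable ordinal,
  the length of the word) and f assigns a letter to each position in Field r
  (values outside Field r are irrelevant). Words are identified up to
  letter-preserving order isomorphism (word_eq).\<close>

type_synonym 'a word = "nat rel \<times> (nat \<Rightarrow> 'a)"

definition wf_word :: "'a word \<Rightarrow> bool" where
  "wf_word x \<longleftrightarrow> Well_order (fst x)"

definition word_eq :: "'a word \<Rightarrow> 'a word \<Rightarrow> bool" where
  "word_eq x y \<longleftrightarrow> wf_word x \<and> wf_word y \<and>
     (\<exists>h. bij_betw h (Field (fst x)) (Field (fst y)) \<and>
          (\<forall>a\<in>Field (fst x). \<forall>b\<in>Field (fst x). (a, b) \<in> fst x \<longleftrightarrow> (h a, h b) \<in> fst y) \<and>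
          (\<forall>a\<in>Field (fst x). snd x a = snd y (h a)))"

definition empty_word :: "'a word" where
  "empty_word = ({}, \<lambda>_. undefined)"

definition letter :: "'a \<Rightarrow> 'a word" where
  "letter a = ({(0, 0)}, \<lambda>_. a)"

definition concat_word :: "'a word \<Rightarrow> 'a word \<Rightarrow> 'a word" where
  "concat_word u v =
    ({(2 * a, 2 * b) | a b. (a, b) \<in> fst u} \<union>
     {(2 * a + 1, 2 * b + 1) | a b. (a, b) \<in> fst v} \<union>
     {(2 * a, 2 * b + 1) | a b. a \<in> Field (fst u) \<and> b \<in> Field (fst v)},
     \<lambda>n. if even n then snd u (n div 2) else snd v (n div 2))"

text \<open>The power y^alpha for a countable ordinal alpha given as a well-order s on a set of
  naturals: alpha copies of y; position (b, a) = position a in copy b, ordered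
  lexicographically (copy index first).\<close>
definition word_pow :: "'a word \<Rightarrow> nat rel \<Rightarrow> 'a word" where
  "word_pow y s =
    ({(prod_encode (b, a), prod_encode (b', a')) | a a' b b'.
        ((b, b') \<in> s \<and> b \<noteq> b' \<and> a \<in> Field (fst y) \<and> a' \<in> Field (fst y)) \<or>
        (b = b' \<and> b \<in> Field s \<and> (a, a') \<in> fst y)},
     \<lambda>n. snd y (snd (prod_decode n)))"

definition omega_ord :: "nat rel" where
  "omega_ord = {(m, n). m \<le> n}"

definition omega_iter :: "'a word \<Rightarrow> 'a word" where
  "omega_iter u = word_pow u omega_ord"

definition omega_pow :: "nat \<Rightarrow> nat list rel" where
  "omega_pow k = {(xs, ys). length xs = k \<and> length ys = k \<and> (xs = ys \<or> (xs, ys) \<in> lex less_than)}"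

definition below_omega_omega :: "nat rel \<Rightarrow> bool" where
  "below_omega_omega s \<longleftrightarrow> Well_order s \<and> (\<exists>k. (s, omega_pow k) \<in> ordLess)"

inductive_set rat_words :: "'a word set" where
  "empty_word \<in> rat_words"
| "letter a \<in> rat_words"
| "u \<in> rat_words \<Longrightarrow> v \<in> rat_words \<Longrightarrow> concat_word u v \<in> rat_words"
| "u \<in> rat_words \<Longrightarrow> omega_iter u \<in> rat_words"

definition rational :: "'a word \<Rightarrow> bool" where
  "rational x \<longleftrightarrow> (\<exists>y\<in>rat_words. word_eq x y)"

definition prefix_word :: "'a word \<Rightarrow> 'a word \<Rightarrow> bool" where
  "prefix_word x x' \<longleftrightarrow> (\<exists>z. wf_word z \<and> word_eq (concat_word x z) x')"

definition str_less :: "'a::linorder word \<Rightarrow> 'a word \<Rightarrow> bool" where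
  "str_less x x' \<longleftrightarrow> (\<exists>y a b z z'. a < b \<and> wf_word y \<and> wf_word z \<and> wf_word z' \<and>
      word_eq x (concat_word y (concat_word (letter a) z)) \<and>
      word_eq x' (concat_word y (concat_word (letter b) z')))"

definition lex_le :: "'a::linorder word \<Rightarrow> 'a word \<Rightarrow> bool" where
  "lex_le x x' \<longleftrightarrow> prefix_word x x' \<or> str_less x x'"

definition lex_less :: "'a::linorder word \<Rightarrow> 'a word \<Rightarrow> bool" where
  "lex_less x x' \<longleftrightarrow> lex_le x x' \<and> \<not> word_eq x x'"

definition primitive :: "'a word \<Rightarrow> bool" where
  "primitive x \<longleftrightarrow> wf_word x \<and>
     (\<forall>y s. wf_word y \<and> Well_order s \<and> word_eq x (word_pow y s) \<longrightarrow>
            card (Field s) = 1 \<and> word_eq y x)"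

text \<open>z is a proper suffix w[gamma,|w|) with 0 < gamma < |w| iff w = y z with y, z nonempty.\<close>
definition prime_word :: "'a::linorder word \<Rightarrow> bool" where
  "prime_word w \<longleftrightarrow> primitive w \<and>
     (\<forall>y z. wf_word y \<and> wf_word z \<and> fst y \<noteq> {} \<and> fst z \<noteq> {} \<and>
            word_eq w (concat_word y z) \<longrightarrow> lex_le w z)"

end

theory Submission
  imports Defs
begin

text \<open>
  Every rational word \<open>x\<close> has only finitely many distinct suffixes, so it has a least nonempty
  suffix \<open>m\<close>. Write \<open>x = x' m\<close> with \<open>x'\<close> as short as possible and recurse on \<open>x'\<close>.
  The word \<open>m\<close> is below all its own suffixes, and the shortest \<open>u\<close> with \<open>m = u\<^sup>\<alpha>\<close> is prime: if a
  proper suffix \<open>z\<close> of \<open>u = s z\<close> were also a prefix of \<open>u\<close>, minimality of \<open>m\<close> would give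
  \<open>s m = z m = m\<close>, and then \<open>u\<^sup>\<omega>\<close> would equal \<open>s\<^sup>\<omega>\<close> or \<open>z\<^sup>\<omega>\<close>, so that \<open>s\<close> or \<open>z\<close> would be a shorter
  root of \<open>m\<close>. If \<open>m'\<close> and \<open>u'\<close> are found at the next step, for \<open>x'\<close>, then \<open>m < m' m\<close>, hence
  \<open>m \<le> m'\<close> and \<open>u \<le> u'\<close>; if \<open>u = u'\<close>, the two powers are merged.
\<close>

subsection \<open>Labelled well-orders\<close>

text \<open>Concatenation of transfinite words cancels on the left but not on the right:
  \<open>q * m = m\<close> is possible with \<open>q\<close> nonempty. This shapes the proof in two
  places. First, \<open>x'\<close> is taken shortest so that \<open>m < q * m\<close> is strict for
  every nonempty suffix \<open>q\<close> of \<open>x'\<close>; strictness is what excludes that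
  \<open>m'\<close> is a proper prefix of \<open>m\<close>. Second, if
  \<open>m = pow u \<alpha>\<close> with \<alpha> a successor, then \<open>u\<close> is a suffix of
  \<open>m\<close> and hence \<open>m = u\<close>; otherwise \<alpha> is a nonzero multiple of
  \<omega>, so \<open>m\<close> absorbs \<open>u\<close> on the left, and the finite-word arguments
  about borders are replaced by the fact that \<open>p * w = w\<close> makes \<open>pow p om\<close>
  a prefix of \<open>w\<close>.

  The argument runs in the monoid of isomorphism classes. Positions are handled only where its basic
  laws are proved: cuts and Levi's lemma, the first mismatch of two words, the place where a prefix
  of a power ends. Natural numbers as exponents are avoided: \<beta> is finite iff
  \<open>om = \<beta> * \<gamma>\<close> with \<open>\<gamma> \<noteq> 1\<close>.

  The bound on the exponents comes from lengths: each exponent is at most the length of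
  \<open>x\<close>, which is at most some finite power of \<omega>.\<close>

lemma Well_orderI:
  assumes "antisym r"
    and least: "\<And>A. A \<subseteq> Field r \<Longrightarrow> A \<noteq> {} \<Longrightarrow> \<exists>a\<in>A. \<forall>b\<in>A. (a, b) \<in> r"
  shows "Well_order r"
proof -
  have tot: "(a, b) \<in> r \<or> (b, a) \<in> r" if "a \<in> Field r" "b \<in> Field r" for a b
    using least[of "{a, b}"] that by auto
  have "(a, c) \<in> r" if "(a, b) \<in> r" "(b, c) \<in> r" for a b c
  proof -
    have "a \<in> Field r" "b \<in> Field r" "c \<in> Field r" using that by (auto simp: Field_def)
    \<comment> \<open>Transitivity from a least element of three: whichever of \<open>a\<close>,
      \<open>b\<close>, \<open>c\<close> it is, antisymmetry leaves \<open>(a, c)\<close>.\<close>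
    then obtain d where "d \<in> {a, b, c}" "(d, a) \<in> r" "(d, b) \<in> r" "(d, c) \<in> r"
      using least[of "{a, b, c}"] by auto
    then show ?thesis using that \<open>antisym r\<close> unfolding antisym_def by blast
  qed
  then have "trans r" by (rule transI)
  moreover have "Refl r" using tot by (auto simp: refl_on_def)
  moreover have "Total r" using tot by (auto simp: total_on_def)
  ultimately have "Linear_order r"
    using \<open>antisym r\<close> by (auto simp: linear_order_on_def partial_order_on_def preorder_on_def Field_def)
  then show ?thesis
    using least by (auto simp: Linear_order_Well_order_iff)
qed

lemma Well_order_least:
  assumes "Well_order r" "A \<subseteq> Field r" "A \<noteq> {}"
  shows "\<exists>a\<in>A. \<forall>b\<in>A. (a, b) \<in> r"
proof -
  have "Linear_order r" using assms(1) by (simp add: well_order_on_def)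
  then show ?thesis using assms by (simp add: Linear_order_Well_order_iff)
qed

lemma Well_order_facts:
  assumes "Well_order r"
  shows "a \<in> Field r \<Longrightarrow> (a, a) \<in> r"
    and "(a, b) \<in> r \<Longrightarrow> (b, a) \<in> r \<Longrightarrow> a = b"
    and "(a, b) \<in> r \<Longrightarrow> (b, c) \<in> r \<Longrightarrow> (a, c) \<in> r"
    and "a \<in> Field r \<Longrightarrow> b \<in> Field r \<Longrightarrow> (a, b) \<in> r \<or> (b, a) \<in> r"
proof -
  have r: "refl_on (Field r) r" "trans r" "antisym r" "total_on (Field r) r"
    using assms
    by (auto simp: well_order_on_def linear_order_on_def partial_order_on_def preorder_on_def)
  show "a \<in> Field r \<Longrightarrow> (a, a) \<in> r" using r(1) by (rule refl_onD)
  then show "a \<in> Field r \<Longrightarrow> b \<in> Field r \<Longrightarrow> (a, b) \<in> r \<or> (b, a) \<in> r"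
    using r(4) by (auto simp: total_on_def)
  show "(a, b) \<in> r \<Longrightarrow> (b, a) \<in> r \<Longrightarrow> a = b" using r(3) by (rule antisymD)
  show "(a, b) \<in> r \<Longrightarrow> (b, c) \<in> r \<Longrightarrow> (a, c) \<in> r" using r(2) by (rule transD)
qed

section \<open>Isomorphism of words\<close>

lemma word_eqI:
  assumes "wf_word x" "wf_word y" "inj_on h (Field (fst x))"
    and "h ` Field (fst x) = Field (fst y)"
    and mono: "\<And>a b. (a, b) \<in> fst x \<Longrightarrow> (h a, h b) \<in> fst y"
    and "\<And>a. a \<in> Field (fst x) \<Longrightarrow> snd x a = snd y (h a)"
  shows "word_eq x y"
  unfolding word_eq_def
proof (intro conjI exI[of _ h] ballI)
  fix a b assume ab: "a \<in> Field (fst x)" "b \<in> Field (fst x)"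
  \<comment> \<open>By totality one direction suffices: if \<open>(a, b)\<close> fails, then
    \<open>(b, a)\<close> holds, so \<open>h a = h b\<close> and \<open>a = b\<close>.\<close>
  show "(a, b) \<in> fst x \<longleftrightarrow> (h a, h b) \<in> fst y"
    using mono[of a b] mono[of b a] ab assms(1-3)
    by (metis Well_order_facts(1,2,4) wf_word_def inj_onD)
qed (use assms in \<open>auto simp: bij_betw_def\<close>)

definition word_iso :: "(nat \<Rightarrow> nat) \<Rightarrow> 'a word \<Rightarrow> 'a word \<Rightarrow> bool" where
  "word_iso h x y \<longleftrightarrow> wf_word x \<and> wf_word y \<and> bij_betw h (Field (fst x)) (Field (fst y)) \<and>
     (\<forall>a\<in>Field (fst x). \<forall>b\<in>Field (fst x). (a, b) \<in> fst x \<longleftrightarrow> (h a, h b) \<in> fst y) \<and>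
     (\<forall>a\<in>Field (fst x). snd x a = snd y (h a))"

lemma word_eq_iff_iso: "word_eq x y \<longleftrightarrow> (\<exists>h. word_iso h x y)"
  by (auto simp: word_eq_def word_iso_def)

lemma word_isoD:
  assumes "word_iso h x y"
  shows "wf_word x" "wf_word y" "inj_on h (Field (fst x))" "h ` Field (fst x) = Field (fst y)"
    "\<And>a b. a \<in> Field (fst x) \<Longrightarrow> b \<in> Field (fst x) \<Longrightarrow> (a, b) \<in> fst x \<longleftrightarrow> (h a, h b) \<in> fst y"
    "\<And>a. a \<in> Field (fst x) \<Longrightarrow> snd x a = snd y (h a)"
  using assms by (auto simp: word_iso_def bij_betw_def)

lemma word_eq_refl: "wf_word x \<Longrightarrow> word_eq x x"
  by (rule word_eqI[where h = id]) auto

lemma word_eq_sym: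
  assumes "word_eq x y" shows "word_eq y x"
proof -
  obtain h where "word_iso h x y"
    using assms word_eq_iff_iso by blast
  note h = word_isoD[OF this]
  let ?g = "the_inv_into (Field (fst x)) h"
  have g: "?g b \<in> Field (fst x)" "h (?g b) = b" if "b \<in> Field (fst y)" for b
    using that h(3,4) by (auto simp: the_inv_into_into f_the_inv_into_f)
  show ?thesis
  proof (rule word_eqI[where h = ?g])
    show "inj_on ?g (Field (fst y))" using inj_on_the_inv_into[OF h(3)] h(4) by simp
    show "?g ` Field (fst y) = Field (fst x)"
      using the_inv_into_onto[OF h(3)] h(4) by simp
    fix a b assume "(a, b) \<in> fst y"
    moreover then have "a \<in> Field (fst y)" "b \<in> Field (fst y)" by (auto simp: Field_def)
    ultimately show "(?g a, ?g b) \<in> fst x" using g h(5) by simp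
  qed (use h g in auto)
qed

lemma word_eq_trans:
  assumes "word_eq x y" "word_eq y z" shows "word_eq x z"
proof -
  obtain h where "word_iso h x y"
    using assms(1) word_eq_iff_iso by blast
  note h = word_isoD[OF this]
  obtain g where "word_iso g y z"
    using assms(2) word_eq_iff_iso by blast
  note g = word_isoD[OF this]
  have hF: "h a \<in> Field (fst y)" if "a \<in> Field (fst x)" for a using that h(4) by blast
  show ?thesis
  proof (rule word_eqI[where h = "g \<circ> h"])
    show "inj_on (g \<circ> h) (Field (fst x))" using h(3,4) g(3) by (simp add: comp_inj_on)
    show "(g \<circ> h) ` Field (fst x) = Field (fst z)" using h(4) g(4) by (metis image_comp)
    fix a b assume ab: "(a, b) \<in> fst x"
    then have "a \<in> Field (fst x)" "b \<in> Field (fst x)" by (auto simp: Field_def)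
    then show "((g \<circ> h) a, (g \<circ> h) b) \<in> fst z" using ab h(5) g(5) hF by simp
  qed (use h(1,6) g(2,6) hF in auto)
qed

section \<open>Concatenation of representatives\<close>

lemma concat_word_iff [simp]:
  "(2 * a, 2 * b) \<in> fst (concat_word u v) \<longleftrightarrow> (a, b) \<in> fst u"
  "(Suc (2 * a), Suc (2 * b)) \<in> fst (concat_word u v) \<longleftrightarrow> (a, b) \<in> fst v"
  "(2 * a, Suc (2 * b)) \<in> fst (concat_word u v) \<longleftrightarrow> a \<in> Field (fst u) \<and> b \<in> Field (fst v)"
  "(Suc (2 * a), 2 * b) \<notin> fst (concat_word u v)"
  unfolding concat_word_def
  by (auto simp: Suc_double_not_eq_double double_not_eq_Suc_double)

lemma snd_concat_word [simp]:
  "snd (concat_word u v) (2 * a) = snd u a"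
  "snd (concat_word u v) (Suc (2 * a)) = snd v a"
  by (simp_all add: concat_word_def)

text \<open>Even positions of a concatenation come from the left factor, odd ones from the right;
  after this split the simplifier can evaluate it.\<close>

lemma nat_double_cases:
  fixes n :: nat
  obtains m where "n = 2 * m" | m where "n = Suc (2 * m)"
  by (metis evenE oddE Suc_eq_plus1)

lemma Field_concat_word [simp]:
  "2 * a \<in> Field (fst (concat_word u v)) \<longleftrightarrow> a \<in> Field (fst u)"
  "Suc (2 * a) \<in> Field (fst (concat_word u v)) \<longleftrightarrow> a \<in> Field (fst v)"
proof -
  let ?r = "fst (concat_word u v)"
  have "a \<in> Field (fst u)" if "(2 * a, n) \<in> ?r \<or> (n, 2 * a) \<in> ?r" for n
    using that by (cases n rule: nat_double_cases) (auto intro: FieldI1 FieldI2)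
  moreover have "2 * a \<in> Field ?r" if "(a, b) \<in> fst u \<or> (b, a) \<in> fst u" for b
    using that concat_word_iff(1) FieldI1 FieldI2 by metis
  ultimately show "2 * a \<in> Field ?r \<longleftrightarrow> a \<in> Field (fst u)"
    by (auto simp: Field_def)
  have "a \<in> Field (fst v)" if "(Suc (2 * a), n) \<in> ?r \<or> (n, Suc (2 * a)) \<in> ?r" for n
    using that by (cases n rule: nat_double_cases) (auto intro: FieldI1 FieldI2)
  moreover have "Suc (2 * a) \<in> Field ?r" if "(a, b) \<in> fst v \<or> (b, a) \<in> fst v" for b
    using that concat_word_iff(2) FieldI1 FieldI2 by metis
  ultimately show "Suc (2 * a) \<in> Field ?r \<longleftrightarrow> a \<in> Field (fst v)"
    by (auto simp: Field_def)
qed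

lemma Field_concat_word_eq:
  "Field (fst (concat_word u v)) =
     (\<lambda>a. 2 * a) ` Field (fst u) \<union> (\<lambda>a. Suc (2 * a)) ` Field (fst v)"
proof (intro set_eqI)
  fix n
  have "2 * a \<noteq> Suc (2 * b)" for a b :: nat by presburger
  then show "n \<in> Field (fst (concat_word u v)) \<longleftrightarrow>
     n \<in> (\<lambda>a. 2 * a) ` Field (fst u) \<union> (\<lambda>a. Suc (2 * a)) ` Field (fst v)"
    by (cases n rule: nat_double_cases) (auto simp: image_iff Suc_double_not_eq_double)
qed

lemma wf_concat_word [intro, simp]:
  assumes "wf_word u" "wf_word v" shows "wf_word (concat_word u v)"
  unfolding wf_word_def
proof (rule Well_orderI)
  note wo = assms[unfolded wf_word_def]
  show "antisym (fst (concat_word u v))"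
  proof (rule antisymI)
    fix m n assume "(m, n) \<in> fst (concat_word u v)" "(n, m) \<in> fst (concat_word u v)"
    then show "m = n"
      using Well_order_facts(2)[OF wo(1)] Well_order_facts(2)[OF wo(2)]
      by (cases m rule: nat_double_cases; cases n rule: nat_double_cases) auto
  qed
  fix A assume A: "A \<subseteq> Field (fst (concat_word u v))" "A \<noteq> {}"
  show "\<exists>a\<in>A. \<forall>b\<in>A. (a, b) \<in> fst (concat_word u v)"
  proof (cases "{a. 2 * a \<in> A} = {}")
    case False
    have "{a. 2 * a \<in> A} \<subseteq> Field (fst u)" using A(1) by auto
    then obtain a where a: "2 * a \<in> A" "\<forall>b. 2 * b \<in> A \<longrightarrow> (a, b) \<in> fst u"
      using Well_order_least[OF wo(1) _ False] by auto
    have "(2 * a, b) \<in> fst (concat_word u v)" if "b \<in> A" for b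
      using that a A(1) by (cases b rule: nat_double_cases) auto
    then show ?thesis using a(1) by blast
  next
    case True
    then have "{a. Suc (2 * a) \<in> A} \<noteq> {}" using A(2) by (metis nat_double_cases empty_Collect_eq equals0I)
    moreover have "{a. Suc (2 * a) \<in> A} \<subseteq> Field (fst v)" using A(1) by auto
    ultimately obtain a where a: "Suc (2 * a) \<in> A" "\<forall>b. Suc (2 * b) \<in> A \<longrightarrow> (a, b) \<in> fst v"
      using Well_order_least[OF wo(2), of "{a. Suc (2 * a) \<in> A}"] by auto
    have "(Suc (2 * a), b) \<in> fst (concat_word u v)" if "b \<in> A" for b
      using that a True by (cases b rule: nat_double_cases) auto
    then show ?thesis using a(1) by blast
  qed
qed

section \<open>Cutting a word at an initial segment\<close>

definition subword :: "'a word \<Rightarrow> nat set \<Rightarrow> 'a word" where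
  "subword x A = (Restr (fst x) A, snd x)"

lemma subword_simps [simp]:
  "(a, b) \<in> fst (subword x A) \<longleftrightarrow> (a, b) \<in> fst x \<and> a \<in> A \<and> b \<in> A"
  "snd (subword x A) = snd x"
  by (auto simp: subword_def)

lemma wf_subword [intro, simp]: "wf_word x \<Longrightarrow> wf_word (subword x A)"
  by (simp add: wf_word_def subword_def Well_order_Restr)

lemma Field_subword [simp]:
  "wf_word x \<Longrightarrow> Field (fst (subword x A)) = Field (fst x) \<inter> A"
  unfolding subword_def wf_word_def
  by (simp add: Refl_Field_Restr well_order_on_def linear_order_on_def partial_order_on_def
      preorder_on_def)

lemma subword_subword: "subword (subword x A) B = subword x (A \<inter> B)"
  by (auto simp: subword_def)

definition down_set :: "nat rel \<Rightarrow> nat set \<Rightarrow> bool" where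
  "down_set r A \<longleftrightarrow> A \<subseteq> Field r \<and> (\<forall>a b. (a, b) \<in> r \<longrightarrow> b \<in> A \<longrightarrow> a \<in> A)"

text \<open>Cuts of one word are nested; this is Levi's lemma on the level of positions.\<close>

lemma down_set_linear:
  assumes "Well_order r" "down_set r A" "down_set r B"
  shows "A \<subseteq> B \<or> B \<subseteq> A"
  using assms Well_order_facts(4)[OF assms(1)] unfolding down_set_def by blast

lemma word_eq_cut:
  assumes x: "wf_word x" and A: "down_set (fst x) A"
  shows "word_eq x (concat_word (subword x A) (subword x (- A)))"
proof (rule word_eqI[where h = "\<lambda>n. if n \<in> A then 2 * n else Suc (2 * n)"])
  let ?h = "\<lambda>n. if n \<in> A then 2 * n else Suc (2 * n)"
  show "inj_on ?h (Field (fst x))"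
    by (intro inj_onI) (auto split: if_splits simp: Suc_double_not_eq_double double_not_eq_Suc_double)
  show "?h ` Field (fst x) = Field (fst (concat_word (subword x A) (subword x (- A))))"
    using x A by (auto simp: Field_concat_word_eq down_set_def)
  fix a b assume "(a, b) \<in> fst x"
  then show "(?h a, ?h b) \<in> fst (concat_word (subword x A) (subword x (- A)))"
    using x A by (auto simp: down_set_def intro: FieldI1 FieldI2)
qed (use x in auto)

lemma concat_word_cong:
  assumes "word_eq u u'" "word_eq v v'"
  shows "word_eq (concat_word u v) (concat_word u' v')"
proof -
  obtain h where "word_iso h u u'"
    using assms(1) word_eq_iff_iso by blast
  note h = word_isoD[OF this]
  obtain g where "word_iso g v v'"
    using assms(2) word_eq_iff_iso by blast
  note g = word_isoD[OF this]
  let ?k = "\<lambda>n. if even n then 2 * h (n div 2) else Suc (2 * g (n div 2))"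
  have k: "?k (2 * a) = 2 * h a" "?k (Suc (2 * a)) = Suc (2 * g a)" for a
    by simp_all
  show ?thesis
  proof (rule word_eqI[where h = ?k])
    show "inj_on ?k (Field (fst (concat_word u v)))"
    proof (rule inj_onI)
      fix m n assume "m \<in> Field (fst (concat_word u v))" "n \<in> Field (fst (concat_word u v))" "?k m = ?k n"
      then show "m = n" using h(3) g(3)
        by (cases m rule: nat_double_cases; cases n rule: nat_double_cases)
          (auto simp: inj_on_def, presburger+)
    qed
    have "?k ` (\<lambda>a. 2 * a) ` X = (\<lambda>a. 2 * a) ` h ` X" for X unfolding image_image k ..
    moreover have "?k ` (\<lambda>a. Suc (2 * a)) ` X = (\<lambda>a. Suc (2 * a)) ` g ` X" for X
      unfolding image_image k ..
    ultimately show "?k ` Field (fst (concat_word u v)) = Field (fst (concat_word u' v'))"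
      unfolding Field_concat_word_eq image_Un h(4) [symmetric] g(4) [symmetric] by simp
    fix m n assume "(m, n) \<in> fst (concat_word u v)"
    then show "(?k m, ?k n) \<in> fst (concat_word u' v')"
      using h(4,5) g(4,5)
      by (cases m rule: nat_double_cases; cases n rule: nat_double_cases)
        (simp_all, (metis FieldI1 FieldI2 imageI)+)
  next
    fix n assume "n \<in> Field (fst (concat_word u v))"
    then show "snd (concat_word u v) n = snd (concat_word u' v') (?k n)"
      using h(6) g(6) by (cases n rule: nat_double_cases) auto
  qed (use h g in auto)
qed

text \<open>Converse of \<open>word_eq_cut\<close>: every factorization arises by cutting
  \<open>x\<close> itself, so that several factorizations can be compared inside one
  carrier.\<close>

lemma word_eq_concat_word_split:
  assumes "word_eq x (concat_word u v)" "wf_word u" "wf_word v"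
  obtains A where "down_set (fst x) A" "word_eq u (subword x A)" "word_eq v (subword x (- A))"
proof -
  let ?c = "concat_word u v"
  obtain h where "word_iso h ?c x"
    using word_eq_sym[OF assms(1)] word_eq_iff_iso by blast
  note h = word_isoD[OF this]
  define A where "A = h ` (\<lambda>a. 2 * a) ` Field (fst u)"
  define B where "B = h ` (\<lambda>a. Suc (2 * a)) ` Field (fst v)"
  have AB: "A \<union> B = Field (fst x)"
    unfolding A_def B_def h(4) [symmetric] Field_concat_word_eq by blast
  have disj: "A \<inter> B = {}"
  proof -
    have "h (2 * a) \<noteq> h (Suc (2 * b))" if "a \<in> Field (fst u)" "b \<in> Field (fst v)" for a b
      using inj_onD[OF h(3), of "2 * a" "Suc (2 * b)"] that by (simp, presburger)
    then show ?thesis unfolding A_def B_def by blast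
  qed
  have FB: "Field (fst x) \<inter> - A = B" using AB disj by blast
  have down: "down_set (fst x) A"
    unfolding down_set_def
  proof (intro conjI allI impI)
    show "A \<subseteq> Field (fst x)" using AB by blast
    fix p q assume pq: "(p, q) \<in> fst x" "q \<in> A"
    then obtain b where b: "b \<in> Field (fst u)" "q = h (2 * b)" by (auto simp: A_def)
    have "p \<in> A \<union> B" using pq(1) AB by (auto intro: FieldI1)
    moreover have False if p: "p \<in> B"
    proof -
      obtain a where a: "a \<in> Field (fst v)" "p = h (Suc (2 * a))" using p by (auto simp: B_def)
      then have "(Suc (2 * a), 2 * b) \<in> fst ?c" using h(5)[of "Suc (2 * a)" "2 * b"] pq(1) b by simp
      then show False by simp
    qed
    ultimately show "p \<in> A" by blast
  qed
  have "word_eq u (subword x A)"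
  proof (rule word_eqI[where h = "\<lambda>a. h (2 * a)"])
    show "inj_on (\<lambda>a. h (2 * a)) (Field (fst u))"
    proof (rule inj_onI)
      fix a b assume "a \<in> Field (fst u)" "b \<in> Field (fst u)" "h (2 * a) = h (2 * b)"
      then show "a = b" using inj_onD[OF h(3), of "2 * a" "2 * b"] by simp
    qed
    show "(\<lambda>a. h (2 * a)) ` Field (fst u) = Field (fst (subword x A))"
      using h(2) AB by (auto simp: A_def image_image)
    fix a b assume ab: "(a, b) \<in> fst u"
    then have "a \<in> Field (fst u)" "b \<in> Field (fst u)" by (auto intro: FieldI1 FieldI2)
    with ab show "(h (2 * a), h (2 * b)) \<in> fst (subword x A)"
      using h(5)[of "2 * a" "2 * b"] by (auto simp: A_def)
  next
    fix a assume "a \<in> Field (fst u)"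
    then show "snd u a = snd (subword x A) (h (2 * a))" using h(6)[of "2 * a"] by simp
  qed (use assms h in auto)
  moreover have "word_eq v (subword x (- A))"
  proof (rule word_eqI[where h = "\<lambda>a. h (Suc (2 * a))"])
    show "inj_on (\<lambda>a. h (Suc (2 * a))) (Field (fst v))"
    proof (rule inj_onI)
      fix a b assume "a \<in> Field (fst v)" "b \<in> Field (fst v)" "h (Suc (2 * a)) = h (Suc (2 * b))"
      then show "a = b" using inj_onD[OF h(3), of "Suc (2 * a)" "Suc (2 * b)"] by simp
    qed
    show "(\<lambda>a. h (Suc (2 * a))) ` Field (fst v) = Field (fst (subword x (- A)))"
      using h(2) FB by (auto simp: B_def image_image)
    fix a b assume ab: "(a, b) \<in> fst v"
    then have F: "a \<in> Field (fst v)" "b \<in> Field (fst v)" by (auto intro: FieldI1 FieldI2)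
    then have "h (Suc (2 * a)) \<notin> A" "h (Suc (2 * b)) \<notin> A"
      using disj by (auto simp: B_def)
    with F ab show "(h (Suc (2 * a)), h (Suc (2 * b))) \<in> fst (subword x (- A))"
      using h(5)[of "Suc (2 * a)" "Suc (2 * b)"] by simp
  next
    fix a assume "a \<in> Field (fst v)"
    then show "snd v a = snd (subword x (- A)) (h (Suc (2 * a)))" using h(6)[of "Suc (2 * a)"] by simp
  qed (use assms h in auto)
  ultimately show ?thesis using that down by blast
qed

section \<open>Powers of representatives\<close>

lemma word_pow_iff [simp]:
  "(prod_encode (b, a), prod_encode (b', a')) \<in> fst (word_pow y s) \<longleftrightarrow>
     (b, b') \<in> s \<and> b \<noteq> b' \<and> a \<in> Field (fst y) \<and> a' \<in> Field (fst y) \<or>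
     b = b' \<and> b \<in> Field s \<and> (a, a') \<in> fst y"
  by (auto simp: word_pow_def)

lemma snd_word_pow [simp]: "snd (word_pow y s) (prod_encode (b, a)) = snd y a"
  by (simp add: word_pow_def)

lemma prod_encode_cases:
  obtains b a where "n = prod_encode (b, a)"
  by (metis prod_decode_inverse surj_pair)

lemma Field_word_pow [simp]:
  "prod_encode (b, a) \<in> Field (fst (word_pow y s)) \<longleftrightarrow> b \<in> Field s \<and> a \<in> Field (fst y)"
proof
  assume "prod_encode (b, a) \<in> Field (fst (word_pow y s))"
  then obtain n where "(prod_encode (b, a), n) \<in> fst (word_pow y s) \<or>
      (n, prod_encode (b, a)) \<in> fst (word_pow y s)"
    by (auto simp: Field_def)
  then show "b \<in> Field s \<and> a \<in> Field (fst y)"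
    by (cases n rule: prod_encode_cases) (auto intro: FieldI1 FieldI2)
next
  assume *: "b \<in> Field s \<and> a \<in> Field (fst y)"
  then obtain a' where "(a, a') \<in> fst y \<or> (a', a) \<in> fst y" by (auto simp: Field_def)
  then have "(prod_encode (b, a), prod_encode (b, a')) \<in> fst (word_pow y s) \<or>
    (prod_encode (b, a'), prod_encode (b, a)) \<in> fst (word_pow y s)"
    using * by simp
  then show "prod_encode (b, a) \<in> Field (fst (word_pow y s))"
    by (metis FieldI1 FieldI2)
qed

lemma Field_word_pow_eq: "Field (fst (word_pow y s)) = prod_encode ` (Field s \<times> Field (fst y))"
proof (intro set_eqI)
  fix n show "n \<in> Field (fst (word_pow y s)) \<longleftrightarrow> n \<in> prod_encode ` (Field s \<times> Field (fst y))"
    by (cases n rule: prod_encode_cases) auto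
qed

lemma wf_word_pow [intro, simp]:
  assumes "wf_word y" "Well_order s" shows "wf_word (word_pow y s)"
  unfolding wf_word_def
proof (rule Well_orderI)
  note y = assms(1)[unfolded wf_word_def]
  show "antisym (fst (word_pow y s))"
  proof (rule antisymI)
    fix m n assume "(m, n) \<in> fst (word_pow y s)" "(n, m) \<in> fst (word_pow y s)"
    then show "m = n"
      using Well_order_facts(2)[OF y] Well_order_facts(2)[OF assms(2)]
      by (cases m rule: prod_encode_cases; cases n rule: prod_encode_cases) auto
  qed
  fix A assume A: "A \<subseteq> Field (fst (word_pow y s))" "A \<noteq> {}"
  have AF: "b \<in> Field s \<and> a \<in> Field (fst y)" if "prod_encode (b, a) \<in> A" for a b
    using A(1) that Field_word_pow by blast
  let ?B = "{b. \<exists>a. prod_encode (b, a) \<in> A}"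
  obtain n where "n \<in> A" using A(2) by blast
  then have "?B \<noteq> {}" by (cases n rule: prod_encode_cases) auto
  moreover have "?B \<subseteq> Field s" using AF by blast
  ultimately have "\<exists>b\<in>?B. \<forall>c\<in>?B. (b, c) \<in> s" by (intro Well_order_least[OF assms(2)])
  then obtain b where b: "b \<in> ?B" "\<forall>c\<in>?B. (b, c) \<in> s" by (rule bexE)
  let ?C = "{a. prod_encode (b, a) \<in> A}"
  have "?C \<noteq> {}" "?C \<subseteq> Field (fst y)" using b(1) AF by blast+
  then obtain a where a: "a \<in> ?C" "\<forall>c\<in>?C. (a, c) \<in> fst y"
    using Well_order_least[OF y, of ?C] by auto
  have "(prod_encode (b, a), n) \<in> fst (word_pow y s)" if "n \<in> A" for n
  proof -
    obtain b' a' where n: "n = prod_encode (b', a')" by (rule prod_encode_cases)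
    have "(b, b') \<in> s" using b(2) that n by blast
    moreover have "b = b' \<Longrightarrow> (a, a') \<in> fst y" using a(2) that n by blast
    ultimately show ?thesis using AF that a(1) n by auto
  qed
  then show "\<exists>a\<in>A. \<forall>b\<in>A. (a, b) \<in> fst (word_pow y s)" using a(1) by blast
qed

text \<open>The exponent is given as the order of a word, so that base and exponent can be passed to
  the quotient by the same relation \<open>word_eq\<close>.\<close>

lemma word_pow_cong:
  assumes "word_eq y y'" "word_eq s s'"
  shows "word_eq (word_pow y (fst s)) (word_pow y' (fst s'))"
proof -
  obtain h where "word_iso h y y'"
    using assms(1) word_eq_iff_iso by blast
  note h = word_isoD[OF this]
  obtain g where "word_iso g s s'"
    using assms(2) word_eq_iff_iso by blast
  note g = word_isoD[OF this]
  let ?k = "\<lambda>n. prod_encode (map_prod g h (prod_decode n))"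
  show ?thesis
  proof (rule word_eqI[where h = ?k])
    show "inj_on ?k (Field (fst (word_pow y (fst s))))"
      using h(3) g(3) unfolding Field_word_pow_eq by (auto simp: inj_on_def)
    show "?k ` Field (fst (word_pow y (fst s))) = Field (fst (word_pow y' (fst s')))"
      unfolding Field_word_pow_eq h(4) [symmetric] g(4) [symmetric]
      by (auto simp: image_iff)
    fix m n assume mn: "(m, n) \<in> fst (word_pow y (fst s))"
    obtain a b c d where [simp]: "m = prod_encode (b, a)" "n = prod_encode (d, c)"
      by (metis prod_encode_cases)
    have "m \<in> Field (fst (word_pow y (fst s)))" "n \<in> Field (fst (word_pow y (fst s)))"
      using mn by (auto intro: FieldI1 FieldI2)
    then have F: "b \<in> Field (fst s)" "d \<in> Field (fst s)" "a \<in> Field (fst y)" "c \<in> Field (fst y)"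
      by simp_all
    have "h a \<in> Field (fst y')" "h c \<in> Field (fst y')" "g b \<in> Field (fst s')"
      using F h(4) g(4) by blast+
    moreover have "g b = g d \<longleftrightarrow> b = d" using inj_onD[OF g(3)] F by blast
    ultimately show "(?k m, ?k n) \<in> fst (word_pow y' (fst s'))"
      using mn F h(5) g(5) by auto
  next
    fix n assume "n \<in> Field (fst (word_pow y (fst s)))"
    then show "snd (word_pow y (fst s)) n = snd (word_pow y' (fst s')) (?k n)"
      using h(6) by (cases n rule: prod_encode_cases) auto
  qed (use h(1,2) g(1,2) in \<open>auto simp: wf_word_def[of s] wf_word_def[of s']\<close>)
qed

section \<open>The order of the naturals, the empty word and letters\<close>

lemma Field_omega_ord [simp]: "Field omega_ord = UNIV"
  by (auto simp: omega_ord_def Field_def)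

lemma omega_ord_iff [simp]: "(m, n) \<in> omega_ord \<longleftrightarrow> m \<le> n"
  by (simp add: omega_ord_def)

lemma Well_order_omega_ord: "Well_order omega_ord"
proof (rule Well_orderI)
  fix A :: "nat set" assume "A \<noteq> {}"
  then have "(LEAST n. n \<in> A) \<in> A" "\<And>b. b \<in> A \<Longrightarrow> (LEAST n. n \<in> A) \<le> b"
    by (auto intro: LeastI Least_le)
  then show "\<exists>a\<in>A. \<forall>b\<in>A. (a, b) \<in> omega_ord" by auto
qed (simp add: antisym_def)

lemma wf_empty_word [simp]: "wf_word empty_word"
  by (simp add: wf_word_def empty_word_def)

lemma Field_empty_word [simp]: "Field (fst empty_word) = {}"
  by (simp add: empty_word_def)

lemma wf_letter [simp]: "wf_word (letter l)"
  unfolding wf_word_def by (rule Well_orderI) (auto simp: letter_def Field_def antisym_def)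

lemma letter_simps [simp]: "(0, 0) \<in> fst (letter l)" "snd (letter l) n = l"
  by (simp_all add: letter_def)

lemma Field_letter [simp]: "Field (fst (letter l)) = {0}"
  by (auto simp: letter_def Field_def)

subsection \<open>Words up to isomorphism\<close>

text \<open>Lengths and exponents, that is, countable ordinals, are represented as words over \<open>unit\<close>.\<close>

quotient_type 'a tword = "'a word" / partial: word_eq
  morphisms rep cls
proof (rule part_equivpI)
  show "\<exists>x :: 'a word. word_eq x x" using word_eq_refl[OF wf_empty_word] by blast
  show "symp word_eq" by (auto intro: sympI word_eq_sym)
  show "transp word_eq" by (auto intro: transpI word_eq_trans)
qed

lemma word_eqD: "word_eq x y \<Longrightarrow> wf_word x" "word_eq x y \<Longrightarrow> wf_word y"
  by (auto simp: word_eq_def)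

lemma wf_word_iff: "wf_word x \<longleftrightarrow> word_eq x x"
  using word_eq_refl word_eqD by blast

lemma cls_eq_iff: "wf_word x \<Longrightarrow> wf_word y \<Longrightarrow> cls x = cls y \<longleftrightarrow> word_eq x y"
  using Quotient3_rel[OF Quotient3_tword] by (metis wf_word_iff)

lemma wf_rep [simp]: "wf_word (rep U)"
  using Quotient3_rel_rep[OF Quotient3_tword, of U U] by (simp add: wf_word_iff)

lemma cls_rep [simp]: "cls (rep U) = U"
  using Quotient3_abs_rep[OF Quotient3_tword] .

lemma Well_order_rep [simp]: "Well_order (fst (rep U))"
  using wf_rep[of U] by (simp add: wf_word_def)

lemma rep_cls: "wf_word x \<Longrightarrow> word_eq (rep (cls x)) x"
  using cls_eq_iff[of "rep (cls x)" x] by simp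

instantiation tword :: (type) "{one, times}"
begin

lift_definition one_tword :: "'a tword" is empty_word
  by (simp add: word_eq_refl)

lift_definition times_tword :: "'a tword \<Rightarrow> 'a tword \<Rightarrow> 'a tword" is concat_word
  by (rule concat_word_cong)

instance ..

end

lift_definition lt :: "'a \<Rightarrow> 'a tword" is letter
  by (simp add: word_eq_refl)

text \<open>For ordinals, that is, words over \<open>unit\<close>, the notation reads as follows:
  \<open>1\<close> is the ordinal zero, \<open>lt ()\<close> is one, \<open>*\<close> is ordinal
  addition, and \<open>pow \<alpha> \<beta>\<close> is the ordinal product of \<alpha> and \<beta>,
  namely \<beta> copies of \<alpha>.\<close>

lift_definition pow :: "'a tword \<Rightarrow> unit tword \<Rightarrow> 'a tword" is "\<lambda>y s. word_pow y (fst s)"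
  by (rule word_pow_cong)

lift_definition len :: "'a tword \<Rightarrow> unit tword" is "\<lambda>x. (fst x, \<lambda>_. ())"
  unfolding word_eq_def by (auto simp: wf_word_def)

abbreviation om :: "unit tword" where "om \<equiv> cls (omega_ord, \<lambda>_. ())"

lemma cls_mult: "wf_word u \<Longrightarrow> wf_word v \<Longrightarrow> cls (concat_word u v) = cls u * cls v"
  by (simp add: times_tword.abs_eq eq_onp_def wf_word_iff)

lemma cls_pow: "wf_word u \<Longrightarrow> wf_word s \<Longrightarrow> cls (word_pow u (fst s)) = pow (cls u) (cls s)"
  by (simp add: pow.abs_eq wf_word_iff)

lemma cls_letter: "cls (letter l) = lt l"
  by (simp add: lt.abs_eq)

lemma cls_len: "wf_word u \<Longrightarrow> len (cls u) = cls (fst u, \<lambda>_. ())"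
  by (simp add: len.abs_eq wf_word_iff)

lemma cls_eqI:
  assumes "wf_word x" "wf_word y" "inj_on h (Field (fst x))"
    and "h ` Field (fst x) = Field (fst y)"
    and "\<And>a b. (a, b) \<in> fst x \<Longrightarrow> (h a, h b) \<in> fst y"
    and "\<And>a. a \<in> Field (fst x) \<Longrightarrow> snd x a = snd y (h a)"
  shows "cls x = cls y"
  using word_eqI[OF assms] assms(1,2) cls_eq_iff by blast

lemma cls_eq_1_iff: "wf_word x \<Longrightarrow> cls x = 1 \<longleftrightarrow> Field (fst x) = {}"
proof
  assume x: "wf_word x"
  {
    assume "cls x = 1"
    then have "word_eq x empty_word" using x by (simp add: one_tword.abs_eq cls_eq_iff)
    then show "Field (fst x) = {}" by (auto simp: word_eq_iff_iso dest: word_isoD(4))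
  next
    assume F: "Field (fst x) = {}"
    then have "fst x = {}" by (auto simp: Field_def)
    then show "cls x = 1"
      unfolding one_tword.abs_eq using x by (intro cls_eqI[where h = id]) auto
  }
qed

section \<open>Cuts of classes and the monoid laws\<close>

lemma cls_cut:
  assumes "wf_word x" "down_set (fst x) A"
  shows "cls x = cls (subword x A) * cls (subword x (- A))"
  using word_eq_cut[OF assms] assms by (simp flip: cls_mult cls_eq_iff)

lemma cls_eq_multE:
  assumes "wf_word x" "cls x = U * V"
  obtains A where "down_set (fst x) A" "U = cls (subword x A)" "V = cls (subword x (- A))"
proof -
  have "cls x = cls (concat_word (rep U) (rep V))" using assms by (simp add: cls_mult)
  then have "word_eq x (concat_word (rep U) (rep V))" using assms(1) by (simp add: cls_eq_iff)
  then obtain A where "down_set (fst x) A" "word_eq (rep U) (subword x A)" 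
    "word_eq (rep V) (subword x (- A))"
    by (rule word_eq_concat_word_split) auto
  then show ?thesis using that assms(1) cls_eq_iff[of "rep U"] cls_eq_iff[of "rep V"] by auto
qed

lemma cls_subword_cut:
  assumes "wf_word x" "down_set (fst x) A" "down_set (fst x) B" "A \<subseteq> B"
  shows "cls (subword x B) = cls (subword x A) * cls (subword x (B - A))"
    and "cls (subword x (- A)) = cls (subword x (B - A)) * cls (subword x (- B))"
proof -
  have "down_set (fst (subword x B)) A" "down_set (fst (subword x (- A))) (B - A)"
    using assms by (auto simp: down_set_def)
  note 1 = cls_cut[OF wf_subword[OF assms(1)] this(1)]
    and 2 = cls_cut[OF wf_subword[OF assms(1)] this(2)]
  have "B \<inter> A = A" "B \<inter> - A = B - A" "- A \<inter> (B - A) = B - A" "- A \<inter> - (B - A) = - B"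
    using assms(4) by auto
  with 1 2 show "cls (subword x B) = cls (subword x A) * cls (subword x (B - A))"
    "cls (subword x (- A)) = cls (subword x (B - A)) * cls (subword x (- B))"
    by (simp_all add: subword_subword)
qed

lemma subword_UNIV [simp]: "subword x UNIV = x"
  by (simp add: subword_def)

instance tword :: (type) monoid_mult
proof
  fix U V W :: "'a tword"
  show "U * V * W = U * (V * W)"
  proof -
    \<comment> \<open>Both cuts are located in one representative of the product; making the shorter
      cut first gives the other bracketing.\<close>
    define x where "x = rep (U * V * W)"
    have x: "wf_word x" "cls x = U * V * W" by (simp_all add: x_def)
    obtain B where B: "down_set (fst x) B" "U * V = cls (subword x B)" "W = cls (subword x (- B))"
      using x by (rule cls_eq_multE)
    obtain A where A: "down_set (fst (subword x B)) A" "U = cls (subword (subword x B) A)"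
      "V = cls (subword (subword x B) (- A))"
      using wf_subword[OF x(1)] B(2)[symmetric] by (rule cls_eq_multE)
    have AB: "A \<subseteq> B" "down_set (fst x) A"
      using A(1) B(1) x(1) by (auto simp: down_set_def)
    have "B \<inter> A = A" "B \<inter> - A = B - A" using AB by auto
    then have U: "U = cls (subword x A)" and V: "V = cls (subword x (B - A))"
      using A by (simp_all add: subword_subword)
    have "cls x = U * (V * W)"
      unfolding U V B(3) cls_subword_cut(2)[OF x(1) AB(2) B(1) AB(1), symmetric]
      by (rule cls_cut[OF x(1) AB(2)])
    then show ?thesis using x(2) by simp
  qed
  have "down_set (fst (rep U)) {}" by (simp add: down_set_def)
  from cls_cut[OF wf_rep this] show "1 * U = U"
    using cls_eq_1_iff[of "subword (rep U) {}"] by simp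
  have "down_set (fst (rep U)) (Field (fst (rep U)))" by (auto simp: down_set_def intro: FieldI1)
  note * = cls_cut[OF wf_rep this]
  moreover have "subword (rep U) (Field (fst (rep U))) = rep U"
    by (auto simp: subword_def Restr_Field)
  ultimately show "U * 1 = U"
    using cls_eq_1_iff[of "subword (rep U) (- Field (fst (rep U)))"] by simp
qed

text \<open>Levi's lemma: both factorizations are cuts of one representative, and the piece between
  the two nested cuts is \<open>Z\<close>.\<close>

lemma levi:
  fixes U V U' V' :: "'a tword"
  assumes "U * V = U' * V'"
  obtains Z where "U' = U * Z" "V = Z * V'" | Z where "U = U' * Z" "V' = Z * V"
proof -
  define x where "x = rep (U * V)"
  have x: "wf_word x" "cls x = U * V" "cls x = U' * V'" using assms by (simp_all add: x_def)
  obtain A where A: "down_set (fst x) A" "U = cls (subword x A)" "V = cls (subword x (- A))"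
    using x(1,2) by (rule cls_eq_multE)
  obtain B where B: "down_set (fst x) B" "U' = cls (subword x B)" "V' = cls (subword x (- B))"
    using x(1,3) by (rule cls_eq_multE)
  consider "A \<subseteq> B" | "B \<subseteq> A"
    using down_set_linear A(1) B(1) x(1) wf_word_def by blast
  then show ?thesis
  proof cases
    case 1
    then show ?thesis using that(1) cls_subword_cut[OF x(1) A(1) B(1)] A B by blast
  next
    case 2
    then show ?thesis using that(2) cls_subword_cut[OF x(1) B(1) A(1)] A B by blast
  qed
qed

lemma mult_eq_1_iff [simp]: "U * V = 1 \<longleftrightarrow> U = 1 \<and> V = 1" for U V :: "'a tword"
proof -
  have "U * V = cls (concat_word (rep U) (rep V))" by (simp add: cls_mult)
  then show ?thesis
    using cls_eq_1_iff[of "concat_word (rep U) (rep V)"] cls_eq_1_iff[of "rep U"]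
      cls_eq_1_iff[of "rep V"]
    by (auto simp: Field_concat_word_eq)
qed

section \<open>Proper prefixes and left cancellation\<close>

definition strict_prefix_rel :: "('a tword \<times> 'a tword) set" where
  "strict_prefix_rel = {(U, U * V) | U V. V \<noteq> 1}"

text \<open>A proper prefix lives on a proper initial segment and so has a smaller order type. The
  relation carries left cancellation, induction on ordinals, and the recursion from \<open>x\<close>
  to \<open>x'\<close>.\<close>

lemma wf_strict_prefix_rel: "wf strict_prefix_rel"
proof -
  have "(fst (rep U), fst (rep (U * V))) \<in> ordLess" if "V \<noteq> 1" for U V :: "'a tword"
  proof -
    define x where "x = rep (U * V)"
    have x: "wf_word x" "cls x = U * V" by (simp_all add: x_def)
    obtain A where A: "down_set (fst x) A" "U = cls (subword x A)" "V = cls (subword x (- A))"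
      using x(1,2) by (rule cls_eq_multE)
    have wo: "Well_order (fst x)" using x(1) by (simp add: wf_word_def)
    have "A \<noteq> Field (fst x)" using A(3) that x(1) by (auto simp: cls_eq_1_iff)
    moreover have "wo_rel.ofilter (fst x) A" using A(1) wo
      by (auto simp: wo_rel.ofilter_def wo_rel_def down_set_def under_def)
    ultimately have "(Restr (fst x) A, fst x) \<in> ordLess"
      using ofilter_ordLess[OF wo] A(1) by (auto simp: down_set_def)
    moreover have "(fst (rep U), Restr (fst x) A) \<in> ordIso"
    proof -
      have "word_eq (rep U) (subword x A)" using A(2) x(1) cls_eq_iff[of "rep U" "subword x A"] by simp
      then obtain h where h: "word_iso h (rep U) (subword x A)" by (auto simp: word_eq_iff_iso)
      then have "iso (fst (rep U)) (fst (subword x A)) h"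
        by (auto simp: iso_iff2 word_iso_def)
      then show ?thesis using word_isoD(1,2)[OF h]
        by (auto simp: ordIso_def wf_word_def subword_def)
    qed
    ultimately show ?thesis using ordIso_ordLess_trans unfolding x_def by blast
  qed
  then have "(strict_prefix_rel :: ('a tword \<times> 'a tword) set) \<subseteq> inv_image ordLess (fst \<circ> rep)"
    by (auto simp: strict_prefix_rel_def inv_image_def)
  then show ?thesis using wf_inv_image[OF wf_ordLess] wf_subset by blast
qed

text \<open>Otherwise \<open>U\<close> would lie strictly below itself in a well-founded relation.
  The mirror image is false, as \<open>lt () * om = om\<close> shows.\<close>

lemma mult_right_eq_self [simp]:
  fixes U V :: "'a tword"
  shows "U * V = U \<longleftrightarrow> V = 1" "U = U * V \<longleftrightarrow> V = 1"
proof -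
  have "V = 1" if "U * V = U"
  proof (rule ccontr)
    assume "V \<noteq> 1"
    then have "(U, U * V) \<in> strict_prefix_rel" by (auto simp: strict_prefix_rel_def)
    then show False using that wf_not_refl[OF wf_strict_prefix_rel, of U] by simp
  qed
  then show "U * V = U \<longleftrightarrow> V = 1" by auto
  then show "U = U * V \<longleftrightarrow> V = 1" by metis
qed

lemma mult_left_cancel [simp]: "U * V = U * W \<longleftrightarrow> V = W" for U V W :: "'a tword"
proof
  assume "U * V = U * W"
  then show "V = W"
  proof (cases rule: levi)
    case (1 Z)
    then have "Z = 1" by (metis mult_right_eq_self)
    then show ?thesis using 1 by simp
  next
    case (2 Z)
    then have "Z = 1" by (metis mult_right_eq_self)
    then show ?thesis using 2 by simp
  qed
qed simp

subsection \<open>Letters\<close>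

lemma lt_neq_1 [simp]: "lt l \<noteq> 1"
  by (simp add: cls_letter[symmetric] cls_eq_1_iff)

lemma lt_inject [simp]: "lt l = lt l' \<longleftrightarrow> l = l'"
proof
  assume "lt l = lt l'"
  then have "word_eq (letter l) (letter l')" by (simp flip: cls_letter add: cls_eq_iff)
  then obtain h where "word_iso h (letter l) (letter l')" by (auto simp: word_eq_iff_iso)
  note h = word_isoD[OF this]
  show "l = l'" using h(6)[of 0] by (simp add: letter_def)
qed simp

lemma lt_eq_mult: "lt l = U * V \<Longrightarrow> U = 1 \<or> V = 1"
proof -
  assume *: "lt l = U * V"
  obtain A where A: "down_set (fst (letter l)) A" "U = cls (subword (letter l) A)"
      "V = cls (subword (letter l) (- A))"
    using wf_letter * cls_letter by (metis cls_eq_multE)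
  then have "A = {} \<or> A = {0}" unfolding down_set_def Field_letter by blast
  then show ?thesis using A(2,3) by (auto simp: cls_eq_1_iff)
qed

lemma lt_mult_inject [simp]: "lt l * U = lt l' * V \<longleftrightarrow> l = l' \<and> U = V"
proof
  assume "lt l * U = lt l' * V"
  then show "l = l' \<and> U = V"
  proof (cases rule: levi)
    case (1 Z)
    then have "Z = 1" using lt_eq_mult[OF 1(1)] by simp
    then show ?thesis using 1 by simp
  next
    case (2 Z)
    then have "Z = 1" using lt_eq_mult[OF 2(1)] by simp
    then show ?thesis using 2 by simp
  qed
qed simp

lemma prefix_lt_cases:
  assumes "U * V = lt l * W" obtains "U = 1" | U' where "U = lt l * U'"
  using assms
proof (cases rule: levi)
  case (1 Z)
  then show ?thesis using lt_eq_mult[OF 1(1)] that by (metis mult_1_right)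
qed (use that in auto)

lemma cls_least:
  assumes "wf_word x" "a \<in> Field (fst x)" "\<And>b. b \<in> Field (fst x) \<Longrightarrow> (a, b) \<in> fst x"
  shows "cls x = lt (snd x a) * cls (subword x (- {a}))"
proof -
  have x: "Well_order (fst x)" using assms(1) by (simp add: wf_word_def)
  have "down_set (fst x) {a}"
    using assms(2,3) Well_order_facts(2)[OF x] by (auto simp: down_set_def intro: FieldI1)
  moreover have "cls (subword x {a}) = lt (snd x a)"
    unfolding cls_letter[symmetric]
  proof (rule cls_eqI[where h = "\<lambda>_. 0"])
    show "(\<lambda>_. 0) ` Field (fst (subword x {a})) = Field (fst (letter (snd x a)))"
      using assms(1,2) by auto
  qed (use assms(1) in \<open>auto simp: inj_on_def\<close>)
  ultimately show ?thesis using cls_cut[OF assms(1)] by simp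
qed

lemma not_1_first_letter:
  assumes "U \<noteq> 1" obtains l V where "U = lt l * V"
proof -
  have "Field (fst (rep U)) \<noteq> {}" using assms cls_eq_1_iff[of "rep U"] by simp
  then obtain a where "a \<in> Field (fst (rep U))" "\<forall>b\<in>Field (fst (rep U)). (a, b) \<in> fst (rep U)"
    using Well_order_least[OF Well_order_rep, of "Field (fst (rep U))"] by blast
  then show ?thesis using cls_least[of "rep U" a] that by simp
qed

text \<open>The embedding places \<open>x\<close> on an initial segment of \<open>y\<close>. The
  least position whose labels disagree is the mismatch; if there is none, \<open>x\<close> is a
  prefix of \<open>y\<close>.\<close>

lemma prefix_or_mismatch_if_embed:
  assumes x: "wf_word x" and y: "wf_word y" and f: "embed (fst x) (fst y) f"
  shows "(\<exists>Z. cls y = cls x * Z) \<or>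
    (\<exists>P l l' U V. l \<noteq> l' \<and> cls x = P * lt l * U \<and> cls y = P * lt l' * V)"
proof -
  have wo: "Well_order (fst x)" "Well_order (fst y)" using x y by (auto simp: wf_word_def)
  have inj: "inj_on f (Field (fst x))" using embed_inj_on[OF wo(1) f] .
  have compat: "(a, b) \<in> fst x \<Longrightarrow> (f a, f b) \<in> fst y" for a b
    using embed_compat[OF f] by (auto simp: compat_def)
  \<comment> \<open>An embedding maps initial segments onto initial segments, so as long as the
    labels agree the two prefixes are the same word.\<close>
  have image: "cls (subword x A) = cls (subword y (f ` A)) \<and> down_set (fst y) (f ` A)"
    if A: "down_set (fst x) A" and agree: "\<forall>a\<in>A. snd x a = snd y (f a)" for A
  proof
    have "wo_rel.ofilter (fst x) A" using A wo(1)
      by (auto simp: wo_rel.ofilter_def wo_rel_def down_set_def under_def)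
    then have "wo_rel.ofilter (fst y) (f ` A)" by (rule embed_preserves_ofilter[OF wo f])
    then show down: "down_set (fst y) (f ` A)" using wo(2)
      by (auto simp: wo_rel.ofilter_def wo_rel_def down_set_def under_def)
    show "cls (subword x A) = cls (subword y (f ` A))"
    proof (rule cls_eqI[where h = f])
      have "A \<subseteq> Field (fst x)" "f ` A \<subseteq> Field (fst y)" using A down by (auto simp: down_set_def)
      then show "f ` Field (fst (subword x A)) = Field (fst (subword y (f ` A)))"
        using x y by (simp add: Int_absorb1)
      show "inj_on f (Field (fst (subword x A)))"
        using inj x by (auto intro: inj_on_subset)
    qed (use x y agree compat in auto)
  qed
  let ?D = "{a \<in> Field (fst x). snd x a \<noteq> snd y (f a)}"
  show ?thesis
  proof (cases "?D = {}")
    case True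
    have "down_set (fst x) (Field (fst x))" by (auto simp: down_set_def intro: FieldI1)
    note this image[OF this]
    moreover have "subword x (Field (fst x)) = x" by (simp add: subword_def Restr_Field)
    ultimately show ?thesis using True cls_cut[OF y] by auto
  next
    case False
    then obtain a where a: "a \<in> ?D" "\<forall>b\<in>?D. (a, b) \<in> fst x"
      using Well_order_least[OF wo(1), of ?D] by blast
    let ?A = "underS (fst x) a"
    have down: "down_set (fst x) ?A"
      using Well_order_facts(2,3)[OF wo(1)]
      by (auto simp: down_set_def underS_def intro: FieldI1)
    have agree: "\<forall>b\<in>?A. snd x b = snd y (f b)"
      using a Well_order_facts(2)[OF wo(1)] by (auto simp: underS_def dest: FieldI1)
    note im = image[OF down agree]
    have fA: "f ` ?A = underS (fst y) (f a)"
      using embed_underS[OF wo(1) f] a(1) by (simp add: bij_betw_def)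
    have "f a \<in> Field (fst y)" using embed_Field[OF f] a(1) by blast
    have tail: "cls (subword z (- underS (fst z) c)) =
        lt (snd z c) * cls (subword z (- underS (fst z) c \<inter> - {c}))"
      if z: "wf_word z" "c \<in> Field (fst z)" for z :: "'a word" and c
    proof -
      have wz: "Well_order (fst z)" using z(1) by (simp add: wf_word_def)
      have "(c, b) \<in> fst z" if "b \<in> Field (fst z)" "b \<notin> underS (fst z) c" for b
        using that z(2) Well_order_facts(1,4)[OF wz] by (auto simp: underS_def)
      then show ?thesis
        using z by (subst cls_least[where a = c]) (auto simp: subword_subword underS_def)
    qed
    have "cls x = cls (subword x ?A) * lt (snd x a) * cls (subword x (- ?A \<inter> - {a}))"
      using cls_cut[OF x down] tail[OF x] a(1) by (simp add: mult.assoc)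
    moreover have "cls y = cls (subword x ?A) * lt (snd y (f a)) *
        cls (subword y (- f ` ?A \<inter> - {f a}))"
      using cls_cut[OF y conjunct2[OF im]] tail[OF y \<open>f a \<in> Field (fst y)\<close>] im fA
      by (simp add: mult.assoc)
    ultimately show ?thesis using a(1) by blast
  qed
qed

lemma prefix_or_mismatch:
  obtains Z where "V = U * Z" | Z where "U = V * Z"
  | P l l' Z Z' where "l \<noteq> l'" "U = P * lt l * Z" "V = P * lt l' * Z'"
proof -
  consider f where "embed (fst (rep U)) (fst (rep V)) f" | f where "embed (fst (rep V)) (fst (rep U)) f"
    using ordLeq_total[OF Well_order_rep Well_order_rep, of U V] by (auto simp: ordLeq_def)
  then show ?thesis
  proof cases
    case 1
    then show ?thesis
      using prefix_or_mismatch_if_embed[OF wf_rep wf_rep 1] that by auto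
  next
    case 2
    then show ?thesis
      using prefix_or_mismatch_if_embed[OF wf_rep wf_rep 2] that by (auto, metis)
  qed
qed

subsection \<open>Powers\<close>

lemma pow_1_right [simp]: "pow U 1 = 1"
proof -
  have "pow U 1 = cls (word_pow (rep U) (fst (empty_word :: unit word)))"
    by (simp add: cls_pow one_tword.abs_eq[symmetric])
  then show ?thesis by (simp add: cls_eq_1_iff Field_word_pow_eq empty_word_def)
qed

lemma pow_eq_cls: "pow U \<alpha> = cls (word_pow (rep U) (fst (rep \<alpha>)))"
  by (simp add: cls_pow)

lemma pow_eq_1_iff [simp]: "pow U \<alpha> = 1 \<longleftrightarrow> U = 1 \<or> \<alpha> = 1"
  using cls_eq_1_iff[of "rep U"] cls_eq_1_iff[of "rep \<alpha>"]
  by (auto simp: pow_eq_cls cls_eq_1_iff Field_word_pow_eq)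

lemma pow_lt [simp]: "pow U (lt l) = U"
proof -
  have "pow U (lt l) = cls (word_pow (rep U) (fst (letter l)))"
    by (simp add: cls_pow cls_letter)
  also have "\<dots> = cls (rep U)"
  proof (rule cls_eqI[where h = "\<lambda>n. snd (prod_decode n)"])
    show "wf_word (word_pow (rep U) (fst (letter l)))"
      using wf_letter unfolding wf_word_def by (intro wf_word_pow[unfolded wf_word_def]) auto
    show "(\<lambda>n. snd (prod_decode n)) ` Field (fst (word_pow (rep U) (fst (letter l)))) =
        Field (fst (rep U))"
      unfolding Field_word_pow_eq Field_letter image_image by auto
    fix m n assume "(m, n) \<in> fst (word_pow (rep U) (fst (letter l)))"
    then show "(snd (prod_decode m), snd (prod_decode n)) \<in> fst (rep U)"
      by (cases m rule: prod_encode_cases; cases n rule: prod_encode_cases)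
        (auto simp: letter_def)
  next
    fix n assume "n \<in> Field (fst (word_pow (rep U) (fst (letter l))))"
    then show "snd (word_pow (rep U) (fst (letter l))) n = snd (rep U) (snd (prod_decode n))"
      by (cases n rule: prod_encode_cases) auto
  qed (auto simp: inj_on_def Field_word_pow_eq)
  finally show ?thesis by simp
qed

lemma pow_mult: "pow U (\<alpha> * \<beta>) = pow U \<alpha> * pow U \<beta>"
proof -
  let ?u = "rep U" and ?c = "concat_word (rep \<alpha>) (rep \<beta>)"
  have "pow U \<alpha> * pow U \<beta> =
      cls (concat_word (word_pow ?u (fst (rep \<alpha>))) (word_pow ?u (fst (rep \<beta>))))"
    by (simp add: cls_mult cls_pow)
  also have "\<dots> = cls (word_pow ?u (fst ?c))" (is "cls ?x = cls ?y")
  proof (rule cls_eqI)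
    \<comment> \<open>Moves the parity bit, which tells the two factors apart, from the position to
      the index of the copy.\<close>
    let ?h = "\<lambda>n. case prod_decode (n div 2) of (b, a) \<Rightarrow>
      prod_encode (if even n then 2 * b else Suc (2 * b), a)"
    have wf: "Well_order (fst ?c)"
      using wf_concat_word[OF wf_rep wf_rep] by (simp add: wf_word_def)
    show "wf_word ?x" "wf_word ?y" using wf by auto
    show "inj_on ?h (Field (fst ?x))"
    proof (rule inj_onI)
      fix m n assume "?h m = ?h n"
      then show "m = n"
        by (cases m rule: nat_double_cases; cases n rule: nat_double_cases;
            cases "m div 2" rule: prod_encode_cases; cases "n div 2" rule: prod_encode_cases)
          (auto simp: Suc_double_not_eq_double double_not_eq_Suc_double)
    qed
    have "?h ` (\<lambda>a. 2 * a) ` prod_encode ` X = prod_encode ` (\<lambda>(b, a). (2 * b, a)) ` X" for X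
      by (simp add: image_image case_prod_unfold)
    moreover have "?h ` (\<lambda>a. Suc (2 * a)) ` prod_encode ` X = prod_encode ` (\<lambda>(b, a). (Suc (2 * b), a)) ` X" for X
      by (simp add: image_image case_prod_unfold)
    ultimately show "?h ` Field (fst ?x) = Field (fst ?y)"
      unfolding Field_word_pow_eq Field_concat_word_eq image_Un
      by (auto simp: image_iff)
    fix m n assume "(m, n) \<in> fst ?x"
    then show "(?h m, ?h n) \<in> fst ?y"
      by (cases m rule: nat_double_cases; cases n rule: nat_double_cases;
          cases "m div 2" rule: prod_encode_cases; cases "n div 2" rule: prod_encode_cases)
        (auto simp: Suc_double_not_eq_double double_not_eq_Suc_double)
  next
    fix n assume "n \<in> Field (fst ?x)"
    then show "snd ?x n = snd ?y (case prod_decode (n div 2) of (b, a) \<Rightarrow>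
      prod_encode (if even n then 2 * b else Suc (2 * b), a))"
      by (cases n rule: nat_double_cases; cases "n div 2" rule: prod_encode_cases) auto
  qed
  also have "\<dots> = pow U (\<alpha> * \<beta>)" by (simp add: cls_pow cls_mult)
  finally show ?thesis by simp
qed

lemma pow_pow: "pow (pow U \<alpha>) \<beta> = pow U (pow \<alpha> \<beta>)"
proof -
  let ?u = "rep U" and ?a = "rep \<alpha>" and ?b = "fst (rep \<beta>)"
  have wf: "Well_order (fst (word_pow ?a ?b))"
    using wf_word_pow[OF wf_rep Well_order_rep] by (simp add: wf_word_def)
  have "pow (pow U \<alpha>) \<beta> = cls (word_pow (word_pow ?u (fst ?a)) ?b)"
    by (simp add: cls_pow)
  also have "\<dots> = cls (word_pow ?u (fst (word_pow ?a ?b)))" (is "cls ?x = cls ?y")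
  proof (rule cls_eqI)
    let ?h = "\<lambda>n. case prod_decode n of (c, m) \<Rightarrow> case prod_decode m of (b, a) \<Rightarrow>
      prod_encode (prod_encode (c, b), a)"
    show "wf_word ?x" "wf_word ?y" using wf by auto
    show "inj_on ?h (Field (fst ?x))"
    proof (rule inj_onI)
      fix m n assume "?h m = ?h n"
      moreover obtain c b a c' b' a' where "m = prod_encode (c, prod_encode (b, a))"
        "n = prod_encode (c', prod_encode (b', a'))"
        by (metis prod_encode_cases)
      ultimately show "m = n" by simp
    qed
    show "?h ` Field (fst ?x) = Field (fst ?y)"
      unfolding Field_word_pow_eq by (force simp: image_iff)
    fix m n assume "(m, n) \<in> fst ?x"
    moreover obtain c b a c' b' a' where "m = prod_encode (c, prod_encode (b, a))"
        "n = prod_encode (c', prod_encode (b', a'))"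
      by (metis prod_encode_cases)
    ultimately show "(?h m, ?h n) \<in> fst ?y" by (auto intro: FieldI1)
  next
    fix n assume "n \<in> Field (fst ?x)"
    moreover obtain c b a where "n = prod_encode (c, prod_encode (b, a))"
      by (metis prod_encode_cases)
    ultimately show "snd ?x n = snd ?y (case prod_decode n of (c, m) \<Rightarrow> case prod_decode m of (b, a) \<Rightarrow>
      prod_encode (prod_encode (c, b), a))" by simp
  qed
  also have "\<dots> = pow U (pow \<alpha> \<beta>)" by (simp add: cls_pow)
  finally show ?thesis by simp
qed

lemma lt_pow [simp]: "pow (lt ()) \<alpha> = \<alpha>"
proof -
  have "pow (lt ()) \<alpha> = cls (word_pow (letter ()) (fst (rep \<alpha>)))"
    by (simp add: cls_pow cls_letter)
  also have "\<dots> = cls (rep \<alpha>)"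
  proof (rule cls_eqI[where h = "\<lambda>n. fst (prod_decode n)"])
    show "(\<lambda>n. fst (prod_decode n)) ` Field (fst (word_pow (letter ()) (fst (rep \<alpha>)))) =
        Field (fst (rep \<alpha>))"
      unfolding Field_word_pow_eq Field_letter image_image by auto
    fix m n assume "(m, n) \<in> fst (word_pow (letter ()) (fst (rep \<alpha>)))"
    then show "(fst (prod_decode m), fst (prod_decode n)) \<in> fst (rep \<alpha>)"
      using Well_order_facts(1)[OF Well_order_rep]
      by (cases m rule: prod_encode_cases; cases n rule: prod_encode_cases) auto
  qed (auto simp: inj_on_def Field_word_pow_eq)
  finally show ?thesis by simp
qed

text \<open>The first position beyond \<open>P\<close> lies in some copy of \<open>U\<close>:
  \<beta> counts the copies before it, \<gamma> those after it, and \<open>U1 * U2\<close> is the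
  cut inside it. All later reasoning about powers goes through this lemma.\<close>

lemma pow_proper_prefixE:
  assumes "pow U \<alpha> = P * Q" "Q \<noteq> 1"
  obtains \<beta> \<gamma> U1 U2 where "\<alpha> = \<beta> * lt () * \<gamma>" "U = U1 * U2" "U2 \<noteq> 1"
    "P = pow U \<beta> * U1" "Q = U2 * pow U \<gamma>"
proof -
  let ?u = "rep U" and ?s = "rep \<alpha>"
  let ?x = "word_pow ?u (fst ?s)"
  have x: "wf_word ?x" by simp
  have u: "Well_order (fst ?u)" and s: "Well_order (fst ?s)" by auto
  have "cls ?x = P * Q" using assms(1) by (simp add: cls_pow)
  with x obtain A where A: "down_set (fst ?x) A" "P = cls (subword ?x A)" "Q = cls (subword ?x (- A))"
    by (rule cls_eq_multE)
  let ?N = "Field (fst ?x) - A"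
  have "?N \<noteq> {}" using A(3) assms(2) x cls_eq_1_iff[of "subword ?x (- A)"] by auto
  then obtain c where c: "c \<in> ?N" "\<forall>d\<in>?N. (c, d) \<in> fst ?x"
    using Well_order_least[of "fst ?x" ?N] x unfolding wf_word_def by blast
  obtain b a where ba: "c = prod_encode (b, a)" by (rule prod_encode_cases)
  have bF: "b \<in> Field (fst ?s)" and aF: "a \<in> Field (fst ?u)" using c(1) ba by auto
  let ?B = "underS (fst ?s) b" and ?C = "underS (fst ?u) a"
  let ?X = "prod_encode ` (?B \<times> Field (fst ?u))" and ?Y = "prod_encode ` ({b} \<times> ?C)"
  have wox: "Well_order (fst ?x)" using x by (simp add: wf_word_def)
  have Ac: "A = underS (fst ?x) c"
  proof (intro set_eqI iffI)
    fix d assume d: "d \<in> A"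
    then have "d \<in> Field (fst ?x)" using A(1) by (auto simp: down_set_def)
    moreover have "(c, d) \<notin> fst ?x" using d c(1) A(1) by (auto simp: down_set_def)
    ultimately show "d \<in> underS (fst ?x) c"
      using Well_order_facts(1,4)[OF wox] c(1) by (auto simp: underS_def)
  next
    fix d assume "d \<in> underS (fst ?x) c"
    then have "(d, c) \<in> fst ?x" "d \<noteq> c" by (auto simp: underS_def)
    then show "d \<in> A" using c(2) Well_order_facts(2)[OF wox] FieldI1 by fastforce
  qed
  \<comment> \<open>The positions before \<open>c = prod_encode (b, a)\<close>: all copies before
    \<open>b\<close>, then the part of copy \<open>b\<close> before \<open>a\<close>.\<close>
  have AXY: "A = ?X \<union> ?Y"
  proof (intro set_eqI)
    fix n show "n \<in> A \<longleftrightarrow> n \<in> ?X \<union> ?Y"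
      unfolding Ac ba using bF aF
      by (cases n rule: prod_encode_cases) (auto simp: underS_def intro: FieldI1)
  qed
  have downB: "down_set (fst ?s) ?B" and downC: "down_set (fst ?u) ?C"
    using Well_order_facts(2,3)[OF s] Well_order_facts(2,3)[OF u]
    by (auto simp: down_set_def underS_def intro: FieldI1)
  have downX: "down_set (fst ?x) ?X"
    unfolding down_set_def
  proof (intro conjI allI impI)
    show "?X \<subseteq> Field (fst ?x)" using downB unfolding Field_word_pow_eq down_set_def by auto
    fix m n assume "(m, n) \<in> fst ?x" "n \<in> ?X"
    then show "m \<in> ?X"
      using downB
      by (cases m rule: prod_encode_cases; cases n rule: prod_encode_cases)
        (auto simp: down_set_def intro: FieldI1)
  qed
  define \<beta> where "\<beta> = cls (subword ?s ?B)"
  define U1 where "U1 = cls (subword ?u ?C)"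
  define U2 where "U2 = cls (subword ?u (- ?C))"
  have "A - ?X = ?Y" unfolding AXY by (auto simp: underS_def)
  then have "P = cls (subword ?x ?X) * cls (subword ?x ?Y)"
    using cls_subword_cut(1)[OF x downX A(1)] A(2) AXY by simp
  also have "cls (subword ?x ?X) = pow U \<beta>"
  proof -
    have "fst (subword ?x ?X) = fst (word_pow ?u (fst (subword ?s ?B)))"
    proof (intro set_eqI)
      fix p :: "nat \<times> nat"
      obtain b1 a1 b2 a2 where "p = (prod_encode (b1, a1), prod_encode (b2, a2))"
        by (metis prod_encode_cases surj_pair)
      then show "p \<in> fst (subword ?x ?X) \<longleftrightarrow> p \<in> fst (word_pow ?u (fst (subword ?s ?B)))"
        using downB by (auto simp: down_set_def intro: FieldI1 FieldI2)
    qed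
    then have "subword ?x ?X = word_pow ?u (fst (subword ?s ?B))"
      by (simp add: prod_eq_iff) (simp add: word_pow_def)
    then show ?thesis by (simp add: \<beta>_def cls_pow)
  qed
  also have "cls (subword ?x ?Y) = U1"
    unfolding U1_def
  proof (rule cls_eqI[where h = "\<lambda>n. snd (prod_decode n)"])
    have YF: "?Y \<subseteq> Field (fst ?x)" using AXY A(1) by (auto simp: down_set_def)
    then have F: "Field (fst (subword ?x ?Y)) = ?Y" by auto
    show "inj_on (\<lambda>n. snd (prod_decode n)) (Field (fst (subword ?x ?Y)))"
      unfolding F by (auto simp: inj_on_def)
    have "?C \<subseteq> Field (fst ?u)" using downC by (simp add: down_set_def)
    then show "(\<lambda>n. snd (prod_decode n)) ` Field (fst (subword ?x ?Y)) = Field (fst (subword ?u ?C))"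
      unfolding F by (auto simp: image_iff)
    fix m n assume "(m, n) \<in> fst (subword ?x ?Y)"
    then show "(snd (prod_decode m), snd (prod_decode n)) \<in> fst (subword ?u ?C)"
      by (cases m rule: prod_encode_cases; cases n rule: prod_encode_cases) auto
  next
    fix n show "snd (subword ?x ?Y) n = snd (subword ?u ?C) (snd (prod_decode n))"
      by (cases n rule: prod_encode_cases) auto
  qed auto
  finally have P: "P = pow U \<beta> * U1" .
  have U12: "U = U1 * U2" using cls_cut[OF wf_rep downC] by (simp add: U1_def U2_def)
  have "U2 \<noteq> 1" using aF by (auto simp: U2_def cls_eq_1_iff underS_def)
  \<comment> \<open>\<delta> is what remains of the exponent; it is nonzero, and its first element
    is the copy in which \<open>P\<close> ends.\<close>
  obtain \<delta> where \<delta>: "\<alpha> = \<beta> * \<delta>" using cls_cut[OF wf_rep downB] by (simp add: \<beta>_def)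
  have "\<delta> \<noteq> 1"
  proof
    assume "\<delta> = 1"
    then have "pow U \<beta> = pow U \<beta> * (U1 * Q)" using assms(1) P \<delta> by (simp add: mult.assoc)
    then show False using assms(2) by (metis mult_eq_1_iff mult_right_eq_self)
  qed
  then obtain \<gamma> where "\<delta> = lt () * \<gamma>" by (metis not_1_first_letter old.unit.exhaust)
  then have \<alpha>: "\<alpha> = \<beta> * lt () * \<gamma>" using \<delta> by (simp add: mult.assoc)
  \<comment> \<open>Only \<open>P\<close> had to be identified by an isomorphism; the shape of
    \<open>Q\<close> follows by left cancellation.\<close>
  have "pow U \<beta> * (U1 * (U2 * pow U \<gamma>)) = pow U \<beta> * (U1 * Q)"
    using assms(1) P U12 unfolding \<alpha> by (simp add: pow_mult mult.assoc)
  then have "Q = U2 * pow U \<gamma>" by simp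
  then show ?thesis using that \<alpha> U12 \<open>U2 \<noteq> 1\<close> P by blast
qed

lemma len_mult [simp]: "len (U * V) = len U * len V"
proof -
  have "len (U * V) = cls (fst (concat_word (rep U) (rep V)), \<lambda>_. ())"
    by (simp add: cls_mult flip: cls_len)
  also have "\<dots> = cls (concat_word (fst (rep U), \<lambda>_. ()) (fst (rep V), \<lambda>_. ()))"
    by (simp add: concat_word_def)
  also have "\<dots> = len (cls (rep U)) * len (cls (rep V))"
    by (simp only: cls_len[OF wf_rep]) (simp add: cls_mult wf_word_def)
  finally show ?thesis by simp
qed

lemma len_pow [simp]: "len (pow U \<alpha>) = pow (len U) \<alpha>"
proof -
  have "len (pow U \<alpha>) = cls (fst (word_pow (rep U) (fst (rep \<alpha>))), \<lambda>_. ())"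
    by (simp add: cls_pow flip: cls_len)
  also have "\<dots> = cls (word_pow (fst (rep U), \<lambda>_. ()) (fst (rep \<alpha>)))"
    by (simp add: word_pow_def)
  also have "\<dots> = pow (len (cls (rep U))) \<alpha>"
    by (simp only: cls_len[OF wf_rep]) (simp add: cls_pow wf_word_def)
  finally show ?thesis by simp
qed

lemma len_eq_1_iff [simp]: "len U = 1 \<longleftrightarrow> U = 1"
proof -
  have "len (cls (rep U)) = 1 \<longleftrightarrow> cls (rep U) = 1"
    by (simp only: cls_len[OF wf_rep]) (simp add: cls_eq_1_iff wf_word_def del: cls_rep)
  then show ?thesis by simp
qed

lemma len_lt [simp]: "len (lt l) = lt ()"
proof -
  have "len (lt l) = cls (fst (letter l), \<lambda>_. ())" by (simp flip: cls_len add: cls_letter)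
  then show ?thesis by (simp flip: cls_letter add: letter_def)
qed

subsection \<open>The ordinal omega\<close>

lemma wf_om [simp]: "wf_word (omega_ord, \<lambda>_. ())"
  unfolding wf_word_def fst_conv by (rule Well_order_omega_ord)

lemma lt_mult_om [simp]: "lt () * om = om"
proof -
  have "om = lt () * cls (subword (omega_ord, \<lambda>_. ()) (- {0}))"
    using cls_least[of "(omega_ord, \<lambda>_. ())" 0] by simp
  also have "cls (subword (omega_ord, \<lambda>_. ()) (- {0})) = om"
  proof (rule cls_eqI[where h = "\<lambda>n. n - 1"])
    show "(\<lambda>n. n - 1) ` Field (fst (subword (omega_ord, \<lambda>_. ()) (- {0}))) =
        Field (fst (omega_ord, \<lambda>_. ()))"
      by (auto simp: image_iff intro!: bexI[of _ "Suc _"])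
    show "inj_on (\<lambda>n. n - 1) (Field (fst (subword (omega_ord, \<lambda>_. ()) (- {0}))))"
      by (auto simp: inj_on_def)
  qed auto
  finally show ?thesis by simp
qed

lemma om_neq_1 [simp]: "om \<noteq> 1"
  by (simp add: cls_eq_1_iff)

text \<open>A proper initial segment of \<omega> is finite, so it is empty or has a last element.
  Applied repeatedly, this replaces induction on natural numbers for finite exponents.\<close>

lemma om_eq_multE:
  assumes "om = \<beta> * \<gamma>" "\<gamma> \<noteq> 1"
  obtains "\<beta> = 1" | \<delta> where "\<beta> = \<delta> * lt ()"
proof -
  let ?o = "(omega_ord, \<lambda>_. ()) :: unit word"
  obtain A where A: "down_set (fst ?o) A" "\<beta> = cls (subword ?o A)" "\<gamma> = cls (subword ?o (- A))"
    using wf_om assms(1) by (rule cls_eq_multE)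
  have "A \<noteq> UNIV" using A(3) assms(2) by (auto simp: cls_eq_1_iff)
  then obtain k where "k \<notin> A" by blast
  then have "A \<subseteq> {..k}" using A(1) by (auto simp: down_set_def) (metis nle_le)
  then have fin: "finite A" by (rule finite_subset) simp
  show ?thesis
  proof (cases "A = {}")
    case True
    then show ?thesis using that(1) A(2) by (simp add: cls_eq_1_iff)
  next
    case False
    let ?m = "Max A"
    have m: "?m \<in> A" "\<forall>a\<in>A. a \<le> ?m" using fin False by auto
    have down: "down_set (fst ?o) (A - {?m})"
      using A(1) m by (auto simp: down_set_def dest: le_antisym)
    have "cls (subword ?o A) = cls (subword ?o (A - {?m})) * cls (subword ?o (A - (A - {?m})))"
      by (rule cls_subword_cut(1)[OF wf_om down A(1)]) auto
    also have "A - (A - {?m}) = {?m}" using m by auto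
    also have "cls (subword ?o {?m}) = lt ()"
    proof -
      have "cls (subword ?o {?m}) = lt () * cls (subword (subword ?o {?m}) (- {?m}))"
        by (subst cls_least[of "subword ?o {?m}" ?m]) auto
      moreover have "cls (subword (subword ?o {?m}) (- {?m})) = 1"
        by (simp add: cls_eq_1_iff)
      ultimately show ?thesis by simp
    qed
    finally show ?thesis using that(2) A(2) by simp
  qed
qed

subsection \<open>The lexicographic order\<close>

definition is_prefix :: "'a tword \<Rightarrow> 'a tword \<Rightarrow> bool" where
  "is_prefix U V \<longleftrightarrow> (\<exists>Z. V = U * Z)"

definition strict_less :: "'a::linorder tword \<Rightarrow> 'a tword \<Rightarrow> bool" where
  "strict_less U V \<longleftrightarrow> (\<exists>P l l' Z Z'. l < l' \<and> U = P * (lt l * Z) \<and> V = P * (lt l' * Z'))"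

text \<open>If \<open>P\<close> were a proper prefix of \<open>Q\<close>, both words would continue
  after \<open>P\<close> with the same letter of \<open>Q\<close>, against
  \<open>l \<noteq> l'\<close>; symmetrically for \<open>Q\<close>. Hence
  \<open>P = Q\<close>.\<close>

lemma mismatch_unique:
  assumes "P * (lt l * Z) = Q * (lt m * W)" "P * (lt l' * Z') = Q * (lt m' * W')"
    and "l \<noteq> l'" "m \<noteq> m'"
  shows "l = m \<and> l' = m'"
  using assms(1)
proof (cases rule: levi)
  case (1 Y)
  from 1(2)[symmetric] show ?thesis
  proof (cases rule: prefix_lt_cases)
    case 1
    then show ?thesis using \<open>Q = P * Y\<close> assms by simp
  next
    case (2 Y')
    then show ?thesis using assms(2,3) \<open>Q = P * Y\<close> by (simp add: mult.assoc)
  qed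
next
  case (2 Y)
  from 2(2)[symmetric] show ?thesis
  proof (cases rule: prefix_lt_cases)
    case 1
    then show ?thesis using \<open>P = Q * Y\<close> assms by simp
  next
    case (2 Y')
    then show ?thesis using assms(2,4) \<open>P = Q * Y\<close> by (simp add: mult.assoc)
  qed
qed

lemma strict_lessI: "l < l' \<Longrightarrow> strict_less (P * (lt l * Z)) (P * (lt l' * Z'))"
  unfolding strict_less_def by blast

lemma strict_less_asym: "strict_less U V \<Longrightarrow> \<not> strict_less V U"
proof
  assume "strict_less U V" "strict_less V U"
  then obtain P l l' Z Z' Q m m' W W' where *: "l < l'" "U = P * (lt l * Z)" "V = P * (lt l' * Z')"
    "m < m'" "V = Q * (lt m * W)" "U = Q * (lt m' * W')"
    unfolding strict_less_def by blast
  then have "l = m' \<and> l' = m" by (intro mismatch_unique[of P l Z Q m' W' l' Z' m W]) auto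
  then show False using *(1,4) by auto
qed

lemma strict_less_mult: "strict_less U V \<Longrightarrow> strict_less (U * X) (V * Y)"
  unfolding strict_less_def by (metis mult.assoc)

lemma not_strict_less_prefix: "strict_less (U * X) U \<Longrightarrow> False" "strict_less U (U * X) \<Longrightarrow> False"
  using strict_less_asym strict_less_mult[of "U * X" U 1 X] strict_less_mult[of U "U * X" X 1]
  by auto

text \<open>The earlier of the two mismatches is a mismatch of \<open>U\<close> and
  \<open>W\<close>; if they coincide, the letters are chained.\<close>

lemma strict_less_trans:
  assumes "strict_less U V" "strict_less V W"
  shows "strict_less U W"
proof -
  from assms obtain P l l' Z Z' Q m m' Y Y' where *: "l < l'" "U = P * (lt l * Z)" "V = P * (lt l' * Z')"
    "m < m'" "V = Q * (lt m * Y)" "W = Q * (lt m' * Y')"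
    unfolding strict_less_def by blast
  have "P * (lt l' * Z') = Q * (lt m * Y)" using * by simp
  then show ?thesis
  proof (cases rule: levi)
    case (1 X)
    from 1(2)[symmetric] show ?thesis
    proof (cases rule: prefix_lt_cases)
      case 1
      then show ?thesis using * \<open>Q = P * X\<close> \<open>lt l' * Z' = X * (lt m * Y)\<close>
        by (auto intro: strict_lessI)
    next
      case (2 X')
      then show ?thesis using * \<open>Q = P * X\<close> unfolding strict_less_def by (metis mult.assoc)
    qed
  next
    case (2 X)
    from 2(2)[symmetric] show ?thesis
    proof (cases rule: prefix_lt_cases)
      case 1
      then show ?thesis using * \<open>P = Q * X\<close> \<open>lt m * Y = X * (lt l' * Z')\<close>
        by (auto intro: strict_lessI)
    next
      case (2 X')
      then show ?thesis using * \<open>P = Q * X\<close> unfolding strict_less_def by (metis mult.assoc)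
    qed
  qed
qed

text \<open>The mismatch of \<open>V\<close> and \<open>W\<close> lies either beyond
  \<open>U\<close> or inside it.\<close>

lemma prefix_strict_less_cases:
  assumes "is_prefix U V" "strict_less V W"
  shows "is_prefix U W \<or> strict_less U W"
proof -
  obtain A P l l' Z Z' where *: "V = U * A" "l < l'" "V = P * (lt l * Z)" "W = P * (lt l' * Z')"
    using assms unfolding is_prefix_def strict_less_def by blast
  have "U * A = P * (lt l * Z)" using * by simp
  then show ?thesis
  proof (cases rule: levi)
    case (1 X)
    then show ?thesis using * unfolding is_prefix_def by (metis mult.assoc)
  next
    case (2 X)
    from 2(2)[symmetric] show ?thesis
    proof (cases rule: prefix_lt_cases)
      case 1
      then show ?thesis using * \<open>U = P * X\<close> unfolding is_prefix_def by simp
    next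
      case (2 X')
      then show ?thesis using * \<open>U = P * X\<close> unfolding strict_less_def by blast
    qed
  qed
qed

section \<open>The lexicographic order as a linear order\<close>

instantiation tword :: (linorder) linorder
begin

definition less_eq_tword :: "'a tword \<Rightarrow> 'a tword \<Rightarrow> bool" where
  "less_eq_tword U V \<longleftrightarrow> is_prefix U V \<or> strict_less U V"

definition less_tword :: "'a tword \<Rightarrow> 'a tword \<Rightarrow> bool" where
  "less_tword U V \<longleftrightarrow> U \<le> V \<and> U \<noteq> V"

instance
proof
  fix U V W :: "'a tword"
  show "U \<le> U" unfolding less_eq_tword_def is_prefix_def by (metis mult_1_right)
  show anti: "U = V" if "U \<le> V" "V \<le> U" for U V :: "'a tword"
  proof -
    have "U = V" if "is_prefix U V" "is_prefix V U"
      using that unfolding is_prefix_def by (metis mult.assoc mult_eq_1_iff mult_right_eq_self mult_1_right)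
    then show ?thesis
      using that strict_less_asym not_strict_less_prefix unfolding less_eq_tword_def is_prefix_def by blast
  qed
  show "(U < V) = (U \<le> V \<and> \<not> V \<le> U)"
    unfolding less_tword_def using anti \<open>U \<le> U\<close> by auto
  show "U \<le> V \<or> V \<le> U"
  proof (cases rule: prefix_or_mismatch[of V U])
    case (3 P l l' Z Z')
    then show ?thesis unfolding less_eq_tword_def strict_less_def by (metis mult.assoc neqE)
  qed (auto simp: less_eq_tword_def is_prefix_def)
  show "U \<le> W" if "U \<le> V" "V \<le> W"
  proof -
    have "is_prefix U W" if "is_prefix U V" "is_prefix V W"
      using that unfolding is_prefix_def by (metis mult.assoc)
    moreover have "strict_less U W" if "strict_less U V" "is_prefix V W"
      using that strict_less_mult[of U V 1] unfolding is_prefix_def by auto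
    ultimately show ?thesis
      using that prefix_strict_less_cases strict_less_trans unfolding less_eq_tword_def by blast
  qed
qed

end

lemma strict_less_imp_less: "strict_less U V \<Longrightarrow> U < V"
  using not_strict_less_prefix(2)[of U 1] by (auto simp: less_tword_def less_eq_tword_def)

lemma le_neqE:
  fixes U V :: "'a::linorder tword"
  assumes "U \<le> V" "U \<noteq> V"
  obtains "strict_less U V" | T where "V = U * T" "T \<noteq> 1"
  using assms by (auto simp: less_eq_tword_def is_prefix_def)

lemma le_mult [simp]: "U \<le> U * V" for U V :: "'a::linorder tword"
  by (auto simp: less_eq_tword_def is_prefix_def)

lemma less_mult: "V \<noteq> 1 \<Longrightarrow> U < U * V" for U V :: "'a::linorder tword"
  by (simp add: less_tword_def)

lemma mult_left_le_iff [simp]: "P * U \<le> P * V \<longleftrightarrow> U \<le> V" for U V :: "'a::linorder tword"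
proof -
  have mono: "P * U \<le> P * V" if "U \<le> V" for U V :: "'a tword"
    using that unfolding less_eq_tword_def is_prefix_def strict_less_def by (metis mult.assoc)
  show ?thesis
  proof
    assume *: "P * U \<le> P * V"
    show "U \<le> V"
    proof (rule ccontr)
      assume "\<not> U \<le> V"
      then have "V < U" by simp
      then have "P * U = P * V" using * mono[of V U] less_imp_le order.antisym by blast
      then show False using \<open>V < U\<close> by simp
    qed
  qed (rule mono)
qed

subsection \<open>Ordinals\<close>

text \<open>With a single letter there are no mismatches, so the lexicographic order is the prefix
  order, which is the usual order of ordinals.\<close>

lemma ordinal_le_iff: "\<alpha> \<le> \<beta> \<longleftrightarrow> (\<exists>\<gamma>. \<beta> = \<alpha> * \<gamma>)" for \<alpha> :: "unit tword"
  by (simp add: less_eq_tword_def is_prefix_def strict_less_def)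

lemma ordinal_less_iff: "\<alpha> < \<beta> \<longleftrightarrow> (\<alpha>, \<beta>) \<in> strict_prefix_rel" for \<alpha> :: "unit tword"
  by (auto simp: less_tword_def ordinal_le_iff strict_prefix_rel_def)

lemma ordinal_induct:
  assumes "\<And>\<alpha>. (\<And>\<beta>. \<beta> < \<alpha> \<Longrightarrow> P \<beta>) \<Longrightarrow> P \<alpha>" shows "P (\<alpha> :: unit tword)"
proof (induction \<alpha> rule: wf_induct_rule[OF wf_strict_prefix_rel])
  case (1 \<alpha>)
  show ?case by (rule assms) (simp add: 1 ordinal_less_iff)
qed

lemma ordinal_least:
  fixes S :: "unit tword set"
  assumes "S \<noteq> {}" shows "\<exists>\<alpha>\<in>S. \<forall>\<beta>\<in>S. \<alpha> \<le> \<beta>"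
proof -
  obtain x where "x \<in> S" using assms by blast
  then obtain \<alpha> where "\<alpha> \<in> S" "\<forall>\<beta>. (\<beta>, \<alpha>) \<in> strict_prefix_rel \<longrightarrow> \<beta> \<notin> S"
    using wfE_min[OF wf_strict_prefix_rel, of x S] by metis
  then have "\<forall>\<beta>\<in>S. \<alpha> \<le> \<beta>" unfolding ordinal_less_iff[symmetric] by (meson not_le)
  then show ?thesis using \<open>\<alpha> \<in> S\<close> by blast
qed

lemma ordinal_le_mult_left [simp]: "\<gamma> \<le> \<beta> * \<gamma>" for \<gamma> :: "unit tword"
proof (induction \<gamma> rule: ordinal_induct)
  case (1 \<gamma>)
  show ?case
  proof (rule ccontr)
    assume "\<not> \<gamma> \<le> \<beta> * \<gamma>"
    then have "\<beta> * \<gamma> < \<gamma>" by simp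
    \<comment> \<open>The induction hypothesis at \<open>\<beta> * \<gamma>\<close> reads
      \<open>\<beta> * \<gamma> \<le> \<beta> * (\<beta> * \<gamma>)\<close>; cancelling \<beta>
      gives the claim.\<close>
    from 1[OF this] this show False by (simp add: not_le[symmetric])
  qed
qed

lemma ordinal_mult_mono:
  fixes \<alpha> :: "unit tword" assumes "\<alpha> \<le> \<beta>" "\<gamma> \<le> \<delta>" shows "\<alpha> * \<gamma> \<le> \<beta> * \<delta>"
proof -
  obtain \<epsilon> where "\<beta> = \<alpha> * \<epsilon>" using assms(1) ordinal_le_iff by auto
  then have "\<alpha> * \<gamma> \<le> \<beta> * \<gamma>" by (simp add: mult.assoc)
  also have "\<dots> \<le> \<beta> * \<delta>" using assms(2) by simp
  finally show ?thesis .
qed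

text \<open>Otherwise \<open>pow \<beta> \<gamma>\<close> ends properly inside copy number \<delta>
  of \<alpha> in \<open>pow \<alpha> \<gamma>\<close>. By induction the first \<delta> copies of
  \<alpha>, and then one more, fit below \<open>pow \<beta> \<gamma>\<close>, so all of \<alpha>
  fits into its proper prefix \<open>a1\<close>.\<close>

lemma ordinal_pow_mono:
  fixes \<alpha> :: "unit tword" assumes "\<alpha> \<le> \<beta>" shows "pow \<alpha> \<gamma> \<le> pow \<beta> \<gamma>"
proof (induction \<gamma> rule: ordinal_induct)
  case (1 \<gamma>)
  show ?case
  proof (rule ccontr)
    assume "\<not> pow \<alpha> \<gamma> \<le> pow \<beta> \<gamma>"
    then have less: "pow \<beta> \<gamma> < pow \<alpha> \<gamma>" by simp
    then obtain Q where "pow \<alpha> \<gamma> = pow \<beta> \<gamma> * Q" by (auto simp: less_le ordinal_le_iff)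
    moreover then have "Q \<noteq> 1" using less by auto
    ultimately obtain \<delta> \<epsilon> a1 a2 where *: "\<gamma> = \<delta> * lt () * \<epsilon>" "\<alpha> = a1 * a2" "a2 \<noteq> 1"
      "pow \<beta> \<gamma> = pow \<alpha> \<delta> * a1"
      by (rule pow_proper_prefixE)
    have "\<delta> < \<gamma>" unfolding *(1) mult.assoc by (intro less_mult) simp
    from ordinal_mult_mono[OF 1[OF this] assms] have "pow \<alpha> \<delta> * \<alpha> \<le> pow \<beta> \<delta> * \<beta>" .
    also have "\<dots> \<le> pow \<beta> \<gamma>" unfolding *(1) pow_mult by simp
    finally have "\<alpha> \<le> a1" unfolding *(4) by simp
    then show False using less_mult[OF *(3), of a1] *(2) by simp
  qed
qed

lemma ordinal_not_1: "\<alpha> \<noteq> 1 \<longleftrightarrow> lt () \<le> \<alpha>"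
proof
  assume "\<alpha> \<noteq> 1"
  then obtain l V where "\<alpha> = lt l * V" by (rule not_1_first_letter)
  then show "lt () \<le> \<alpha>" by simp
qed (auto simp: ordinal_le_iff)

text \<open>Zero, successor, or a nonzero multiple of \<omega>. As \<alpha> is a prefix of
  \<open>pow om \<alpha>\<close>, it consists of \<beta> full copies of \<omega> and a finite rest,
  unless it is all of \<open>pow om \<alpha>\<close>.\<close>

lemma ordinal_cases:
  obtains "\<alpha> = 1" | \<gamma> where "\<alpha> = \<gamma> * lt ()" | \<beta> where "\<beta> \<noteq> 1" "\<alpha> = pow om \<beta>"
proof -
  have "lt () \<le> om" using ordinal_not_1[of om] by simp
  then have "\<alpha> \<le> pow om \<alpha>" using ordinal_pow_mono[of "lt ()" om \<alpha>] by simp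
  then obtain Q where Q: "pow om \<alpha> = \<alpha> * Q" by (auto simp: ordinal_le_iff)
  show ?thesis
  proof (cases "Q = 1")
    case True
    then show ?thesis using that(1) that(3)[of \<alpha>] Q by auto
  next
    case False
    with Q obtain \<beta> \<gamma> U1 U2 where *: "om = U1 * U2" "U2 \<noteq> 1" "\<alpha> = pow om \<beta> * U1"
      by (rule pow_proper_prefixE)
    from *(1,2) show ?thesis
    proof (cases rule: om_eq_multE)
      case 1
      then show ?thesis using * that(1) that(3)[of \<beta>] by (cases "\<beta> = 1") auto
    next
      case (2 \<delta>)
      then show ?thesis using *(3) that(2)[of "pow om \<beta> * \<delta>"] by (simp add: mult.assoc)
    qed
  qed
qed

section \<open>Absorption on the left\<close>

lemma pow_lt_mult [simp]: "pow U (lt () * \<alpha>) = U * pow U \<alpha>"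
  by (simp add: pow_mult)

lemma not_1_pow: "\<alpha> \<noteq> 1 \<Longrightarrow> \<exists>\<beta>. pow U \<alpha> = U * pow U \<beta> \<and> \<alpha> = lt () * \<beta>"
  by (metis ordinal_not_1 ordinal_le_iff pow_lt_mult)

lemma mult_pow_om [simp]: "U * pow U om = pow U om"
  by (metis lt_mult_om pow_lt_mult)

lemma finite_pow_absorb:
  assumes "p * w = w" "om = \<beta> * \<gamma>" "\<gamma> \<noteq> 1"
  shows "pow p \<beta> * w = w"
  using assms(2,3)
proof (induction \<beta> arbitrary: \<gamma> rule: ordinal_induct)
  case (1 \<beta>)
  from 1(2,3) show ?case
  proof (cases rule: om_eq_multE)
    case (2 \<delta>)
    have "\<delta> < \<beta>" unfolding 2 by (rule less_mult) simp
    then have "pow p \<delta> * w = w" using 1(1)[of \<delta> "lt () * \<gamma>"] 1(2) 2 by (simp add: mult.assoc)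
    then show ?thesis using assms(1) 2 by (simp add: pow_mult mult.assoc)
  qed simp
qed

text \<open>Since \<open>w\<close> absorbs every finite power of \<open>p\<close>, it can neither
  end inside a copy of \<open>p\<close> in \<open>pow p om\<close> nor differ from it there.\<close>

lemma absorb_imp_om_prefix:
  assumes "p * w = w"
  obtains r where "w = pow p om * r"
proof (cases rule: prefix_or_mismatch[of w "pow p om"])
  case (1 Z)
  then show ?thesis by (rule that)
next
  case (2 Z)
  show ?thesis
  proof (cases "Z = 1")
    case True
    then show ?thesis using 2 that[of 1] by simp
  next
    case False
    with 2 obtain \<beta> \<gamma> p1 p2 where *: "om = \<beta> * lt () * \<gamma>" "p = p1 * p2" "p2 \<noteq> 1"
      "w = pow p \<beta> * p1"
      by (rule pow_proper_prefixE)
    have "pow p \<beta> * w = w"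
      using assms *(1) by (intro finite_pow_absorb[of p w \<beta> "lt () * \<gamma>"]) (simp_all add: mult.assoc)
    \<comment> \<open>Absorbing the \<beta> complete copies and cancelling them leaves
      \<open>w\<close> inside a single copy of \<open>p\<close>.\<close>
    then have "w = p1" using *(4) by (metis mult_left_cancel)
    then have "p1 * (p2 * w) = p1" using assms *(2) by (simp add: mult.assoc)
    then show ?thesis using *(3) by simp
  qed
next
  case (3 P l l' Z Z')
  have "pow p om = P * (lt l * Z)" "lt l * Z \<noteq> 1" using 3 by (simp_all add: mult.assoc)
  then obtain \<beta> \<gamma> p1 p2 where *: "om = \<beta> * lt () * \<gamma>" "p = p1 * p2" "p2 \<noteq> 1"
      "P = pow p \<beta> * p1" "lt l * Z = p2 * pow p \<gamma>"
    by (rule pow_proper_prefixE)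
  obtain p3 where p3: "p2 = lt l * p3"
    using *(5)[symmetric] *(3) by (auto elim: prefix_lt_cases)
  have "pow p \<beta> * w = w"
    using assms *(1) by (intro finite_pow_absorb[of p w \<beta> "lt () * \<gamma>"]) (simp_all add: mult.assoc)
  \<comment> \<open>After \<beta> copies \<open>w\<close> continues with one more full copy of
    \<open>p\<close>, the copy that contains the supposed mismatch.\<close>
  then have "w = pow p \<beta> * (p * w)" using assms by simp
  also have "\<dots> = P * (lt l * (p3 * w))" using *(2,4) p3 by (simp add: mult.assoc)
  finally have "l = l'" using 3(3) by (simp add: mult.assoc)
  then show ?thesis using 3(1) by simp
qed

subsection \<open>Words that are minimal among their suffixes\<close>

definition suffix_min :: "'a::linorder tword \<Rightarrow> bool" where
  "suffix_min w \<longleftrightarrow> w \<noteq> 1 \<and> (\<forall>p q. w = p * q \<longrightarrow> q \<noteq> 1 \<longrightarrow> w \<le> q)"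

definition shortest_root :: "'a tword \<Rightarrow> 'a tword \<Rightarrow> bool" where
  "shortest_root u w \<longleftrightarrow> (\<exists>\<alpha>. w = pow u \<alpha>) \<and> (\<forall>v \<beta>. w = pow v \<beta> \<longrightarrow> len u \<le> len v)"

definition prime_tword :: "'a::linorder tword \<Rightarrow> bool" where
  "prime_tword u \<longleftrightarrow> (\<forall>y \<beta>. u = pow y \<beta> \<longrightarrow> \<beta> = lt () \<and> y = u) \<and>
     (\<forall>p q. u = p * q \<longrightarrow> p \<noteq> 1 \<longrightarrow> q \<noteq> 1 \<longrightarrow> u \<le> q)"

lemma prime_tword_neq_1: "prime_tword u \<Longrightarrow> u \<noteq> 1"
  unfolding prime_tword_def by (metis pow_1_right lt_neq_1)

lemma shortest_root_exists: obtains u where "shortest_root u w"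
proof -
  let ?S = "{len v | v. \<exists>\<beta>. w = pow v \<beta>}"
  have "len w \<in> ?S" using pow_lt by (metis (mono_tags, lifting) mem_Collect_eq)
  then obtain z where "z \<in> ?S" "\<forall>y\<in>?S. z \<le> y" using ordinal_least[of ?S] by blast
  then show ?thesis using that unfolding shortest_root_def by blast
qed

text \<open>A root \<open>y\<close> of \<open>u\<close> is a root of \<open>w\<close> too, so it is
  no shorter than \<open>u\<close>; in \<open>u = y * pow y \<gamma>\<close> this leaves no length
  for the second factor.\<close>

lemma shortest_root_primitive:
  assumes "w \<noteq> 1" "shortest_root u w" "u = pow y \<beta>"
  shows "\<beta> = lt () \<and> y = u"
proof -
  obtain \<alpha> where \<alpha>: "w = pow u \<alpha>" using assms(2) by (auto simp: shortest_root_def)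
  then have le: "len u \<le> len y" using assms(2,3) by (auto simp: shortest_root_def pow_pow)
  have "u \<noteq> 1" using assms(1) \<alpha> by auto
  then have y: "y \<noteq> 1" and "\<beta> \<noteq> 1" using assms(3) by auto
  then obtain \<gamma> where \<gamma>: "\<beta> = lt () * \<gamma>" using not_1_pow by metis
  have "len u = len y * len (pow y \<gamma>)" using assms(3) unfolding \<gamma> by simp
  then have "len (pow y \<gamma>) = 1" using le less_mult[of "len (pow y \<gamma>)" "len y"]
    by (metis not_le)
  then have "\<gamma> = 1" using y by (metis len_eq_1_iff pow_eq_1_iff)
  then show ?thesis using assms(3) \<gamma> by simp
qed

text \<open>The longer of \<open>s\<^sup>\<omega>\<close> and \<open>z\<^sup>\<omega>\<close> absorbs both \<open>s\<close> and \<open>z\<close>, hence \<open>u\<close>, and so it is \<open>u\<^sup>\<omega>\<close>.\<close>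

lemma om_root_if_absorbed:
  assumes "u = s * z" "u = z * t" "z \<noteq> 1" "t \<noteq> 1" "s * w = w" "z * w = w"
  obtains v where "len v < len u" "pow v om = pow u om"
proof -
  have main: "pow v om = pow u om" if v: "s * pow v om = pow v om" "z * pow v om = pow v om" "len v \<le> len u" for v
  proof -
    have "u * pow v om = pow v om" using v(1,2) assms(1) by (simp add: mult.assoc)
    then obtain r where r: "pow v om = pow u om * r" by (rule absorb_imp_om_prefix)
    then have "len (pow v om) = len (pow u om) * len r" by simp
    \<comment> \<open>The reverse comparison of lengths: since \<open>v\<close> is no longer than
      \<open>u\<close>, nothing is left for \<open>r\<close>.\<close>
    moreover have "len (pow v om) \<le> len (pow u om)" using v(3) by (simp add: ordinal_pow_mono)
    ultimately have "len r = 1" using less_mult[of "len r" "len (pow u om)"] by (metis not_le)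
    then show ?thesis using r by simp
  qed
  have s: "len s < len u" and z: "len z < len u"
    using assms(1-4) less_mult[of "len z" "len s"] less_mult[of "len t" "len z"]
    by (simp, metis len_mult len_eq_1_iff)
  obtain r1 r2 where "w = pow s om * r1" "w = pow z om * r2"
    using absorb_imp_om_prefix[OF assms(5)] absorb_imp_om_prefix[OF assms(6)] by metis
  then have "pow s om * r1 = pow z om * r2" by simp
  then show ?thesis
  proof (cases rule: levi)
    case (1 Z)
    have "s * pow z om = pow z om" unfolding 1 by (simp flip: mult.assoc)
    then show ?thesis using main[of z] z that by auto
  next
    case (2 Z)
    have "z * pow s om = pow s om" unfolding 2 by (simp flip: mult.assoc)
    then show ?thesis using main[of s] s that by auto
  qed
qed

lemma shortest_root_prime:
  assumes w: "suffix_min w" and u: "shortest_root u w"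
  shows "prime_tword u"
  unfolding prime_tword_def
proof (intro conjI allI impI)
  have min: "w \<le> q" if "w = p * q" "q \<noteq> 1" for p q using w that by (auto simp: suffix_min_def)
  have w1: "w \<noteq> 1" using w by (simp add: suffix_min_def)
  show "\<beta> = lt ()" "y = u" if "u = pow y \<beta>" for y \<beta>
    using shortest_root_primitive[OF w1 u that] by auto
  obtain \<alpha> where \<alpha>: "w = pow u \<alpha>" using u by (auto simp: shortest_root_def)
  then have u1: "u \<noteq> 1" "\<alpha> \<noteq> 1" using w1 by auto
  fix s z assume sz: "u = s * z" "s \<noteq> 1" "z \<noteq> 1"
  show "u \<le> z"
  proof (cases rule: ordinal_cases[of \<alpha>])
    case 1
    then show ?thesis using u1 by simp
  next
    case (2 \<gamma>)
    \<comment> \<open>For a successor exponent \<open>u\<close> is both a prefix and a suffix of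
      \<open>w\<close>, so minimality gives \<open>w = u\<close>.\<close>
    have "w \<le> u" using min[of "pow u \<gamma>" u] u1 \<alpha> 2 by (simp add: pow_mult)
    moreover have "u \<le> w" using not_1_pow[OF u1(2), of u] \<alpha> by auto
    ultimately have "w = u" by simp
    then show ?thesis using min[of s z] sz by simp
  next
    case (3 \<beta>)
    \<comment> \<open>Here \<alpha> is a nonzero multiple of \<omega>, so \<open>w\<close> begins
      with \<open>pow u om\<close> and absorbs one more \<open>u\<close> in front.\<close>
    have "pow u om * pow (pow u om) \<gamma> = u * (pow u om * pow (pow u om) \<gamma>)" for \<gamma>
      by (simp flip: mult.assoc)
    then have uw: "u * w = w" using not_1_pow[OF 3(1), of "pow u om"] \<alpha> 3 pow_pow by metis
    have zw: "w \<le> z * w" using min[of s "z * w"] uw sz by (simp add: mult.assoc)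
    show ?thesis
    proof (rule ccontr)
      assume "\<not> u \<le> z"
      then have "z \<le> u" "z \<noteq> u" by auto
      then consider "strict_less z u" | t where "u = z * t" "t \<noteq> 1" by (rule le_neqE)
      then show False
      proof cases
        case 1
        then have "z * w < u * w" by (intro strict_less_imp_less strict_less_mult)
        then show False using zw uw by simp
      next
        case (2 t)
        have "w = z * (t * w)" using uw 2 by (simp add: mult.assoc)
        \<comment> \<open>Cancelling \<open>z\<close> in \<open>z * (t * w) \<le> z * w\<close>. The
          reverse inequality holds because \<open>t * w\<close> is a suffix of
          \<open>w\<close>.\<close>
        with zw have "t * w \<le> w" by (metis mult_left_le_iff)
        moreover have "w \<le> t * w" using min[of z "t * w"] \<open>w = z * (t * w)\<close> w1 by simp
        ultimately have "t * w = w" by simp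
        with \<open>w = z * (t * w)\<close> have zw: "z * w = w" by simp
        moreover have "s * w = w" using zw uw sz(1) by (simp add: mult.assoc)
        ultimately obtain v where v: "len v < len u" "pow v om = pow u om"
          using om_root_if_absorbed[OF sz(1) 2(1) sz(3) 2(2)] by blast
        have "w = pow v (pow om \<beta>)" using \<alpha> 3 v(2) by (metis pow_pow)
        then show False using u v(1) by (auto simp: shortest_root_def not_less[symmetric])
      qed
    qed
  qed
qed

text \<open>If \<open>u'\<close> were a proper prefix of \<open>u\<close>, it would be too short to
  be a root of \<open>m\<close>. As \<open>m \<le> m'\<close> and \<open>m\<close> is no power of
  \<open>u'\<close>, \<open>m\<close> ends inside a copy of \<open>u'\<close> in \<open>m'\<close>
  or drops below \<open>m'\<close> there. The suffix of \<open>m\<close> that starts with this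
  interrupted copy is then smaller than \<open>m\<close>, because \<open>m\<close> itself starts
  with a full \<open>u'\<close>.\<close>

lemma shortest_root_mono:
  assumes m: "suffix_min m" and u: "shortest_root u m"
    and m': "m' = pow u' \<alpha>'" "m' \<noteq> 1" and le: "m \<le> m'"
  shows "u \<le> u'"
proof (rule ccontr)
  have min: "m \<le> q" if "m = p * q" "q \<noteq> 1" for p q using m that by (auto simp: suffix_min_def)
  have m1: "m \<noteq> 1" using m by (simp add: suffix_min_def)
  obtain r where r: "m = u * r" using u m1 not_1_pow by (metis shortest_root_def pow_1_right)
  assume "\<not> u \<le> u'"
  then have "u' \<le> u" "u' \<noteq> u" by auto
  then consider "strict_less u' u" | t where "u = u' * t" "t \<noteq> 1" by (rule le_neqE)
  then show False
  proof cases
    case 1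
    obtain r' where "m' = u' * r'" using m' not_1_pow by (metis pow_1_right)
    then have "m' < m" using 1 r by (auto intro: strict_less_imp_less strict_less_mult)
    then show False using le by simp
  next
    case (2 t)
    have short: "len u' < len u" using 2 less_mult[of "len t" "len u'"] by simp
    have no_root: "m \<noteq> pow u' \<beta>" for \<beta>
      using u short by (auto simp: shortest_root_def not_less[symmetric])
    show False
    proof (cases rule: prefix_or_mismatch[of m m'])
      case (1 Z)
      then have "m' \<le> m" by simp
      then have "m = m'" using le by (rule order.antisym[rotated])
      then show False using no_root[of \<alpha>'] m'(1) by simp
    next
      case (2 Z)
      then have "pow u' \<alpha>' = m * Z" using m' by simp
      moreover have "Z \<noteq> 1" using 2 m'(1) no_root[of \<alpha>'] by auto
      ultimately obtain \<beta> \<gamma> a1 a2 where *: "u' = a1 * a2" "a2 \<noteq> 1" "m = pow u' \<beta> * a1"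
        by (rule pow_proper_prefixE)
      have "a1 \<noteq> 1" using * no_root[of \<beta>] by auto
      \<comment> \<open>The interrupted copy \<open>a1\<close> is a suffix of \<open>m\<close>, but
        also a proper prefix of it.\<close>
      then have "m \<le> a1" using min *(3) by blast
      moreover have ma: "m = a1 * (a2 * (t * r))" using r \<open>u = u' * t\<close> *(1) by (simp add: mult.assoc)
      ultimately have "m = a1" by (metis le_mult order.antisym)
      then have "a1 * (a2 * (t * r)) = a1" using ma by simp
      then show False using *(2) by simp
    next
      case (3 P l' l Z' Z)
      have "\<not> l' < l"
      proof
        assume "l' < l"
        then have "strict_less m' m" using 3 by (auto simp: mult.assoc intro: strict_lessI)
        then show False using le strict_less_imp_less leD by blast
      qed
      then have "l < l'" using 3(1) by simp
      have "pow u' \<alpha>' = P * (lt l' * Z')" "lt l' * Z' \<noteq> 1" using 3(2) m'(1) by (auto simp: mult.assoc)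
      then obtain \<beta> \<gamma> a1 a2 where *: "u' = a1 * a2" "a2 \<noteq> 1" "P = pow u' \<beta> * a1"
        "lt l' * Z' = a2 * pow u' \<gamma>"
        by (rule pow_proper_prefixE)
      obtain a3 where a3: "a2 = lt l' * a3"
        using *(4)[symmetric] *(2) by (auto elim: prefix_lt_cases)
      have "m = pow u' \<beta> * (a1 * (lt l * Z))" using 3(3) * by (simp add: mult.assoc)
      \<comment> \<open>This suffix has \<open>l\<close> where \<open>m\<close>, starting with
        \<open>u'\<close>, has the larger letter \<open>l'\<close>.\<close>
      then have "m \<le> a1 * (lt l * Z)" by (rule min) simp
      moreover have "m = a1 * (lt l' * (a3 * (t * r)))"
        using r \<open>u = u' * t\<close> *(1) a3 by (simp add: mult.assoc)
      then have "a1 * (lt l * Z) < m"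
        using strict_less_imp_less[OF strict_lessI[OF \<open>l < l'\<close>]] by metis
      ultimately show False by simp
    qed
  qed
qed

subsection \<open>Rational words\<close>

inductive_set rational_twords :: "'a tword set" where
  "1 \<in> rational_twords"
| "lt l \<in> rational_twords"
| "U \<in> rational_twords \<Longrightarrow> V \<in> rational_twords \<Longrightarrow> U * V \<in> rational_twords"
| "U \<in> rational_twords \<Longrightarrow> pow U om \<in> rational_twords"

text \<open>The hypotheses say that \<beta> is finite. The induction also yields that removing a
  finite beginning from \<omega> leaves \<omega>.\<close>

lemma finite_pow_rational:
  assumes "U \<in> rational_twords" "om = \<beta> * \<gamma>" "\<gamma> \<noteq> 1"
  shows "pow U \<beta> \<in> rational_twords \<and> \<gamma> = om"
  using assms(2,3)
proof (induction \<beta> arbitrary: \<gamma> rule: ordinal_induct)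
  case (1 \<beta>)
  from 1(2,3) show ?case
  proof (cases rule: om_eq_multE)
    case 1
    then show ?thesis using \<open>om = \<beta> * \<gamma>\<close> by (simp add: rational_twords.intros)
  next
    case (2 \<delta>)
    have "\<delta> < \<beta>" unfolding 2 by (rule less_mult) simp
    then have IH: "pow U \<delta> \<in> rational_twords" "lt () * \<gamma> = om"
      using 1(1)[of \<delta> "lt () * \<gamma>"] 1(2) 2 by (simp_all add: mult.assoc)
    have "lt () * \<gamma> = lt () * om" using IH(2) by simp
    then have "\<gamma> = om" by (simp del: lt_mult_om)
    then show ?thesis using IH(1) assms(1) 2 by (simp add: pow_mult rational_twords.intros)
  qed
qed

lemma pow_om_eq_multE:
  assumes "pow U om = P * Q" "Q \<noteq> 1"
  obtains \<beta> U1 U2 where "om = \<beta> * om" "U = U1 * U2" "P = pow U \<beta> * U1" "Q = U2 * pow U om"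
    "U \<in> rational_twords \<Longrightarrow> pow U \<beta> \<in> rational_twords"
proof -
  obtain \<beta> \<gamma> U1 U2 where *: "om = \<beta> * lt () * \<gamma>" "U = U1 * U2" "U2 \<noteq> 1"
    "P = pow U \<beta> * U1" "Q = U2 * pow U \<gamma>"
    using assms by (rule pow_proper_prefixE)
  have om: "om = \<beta> * (lt () * \<gamma>)" using *(1) by (simp add: mult.assoc)
  \<comment> \<open>Only the statement about the remainder of \<omega> is wanted, so the empty word
    over \<open>unit\<close> serves as base.\<close>
  have "lt () * \<gamma> = om"
    using finite_pow_rational[OF rational_twords.intros(1)[where 'a = unit] om] by simp
  moreover from this have "lt () * \<gamma> = lt () * om" by simp
  then have "\<gamma> = om" by (simp del: lt_mult_om)
  ultimately have "om = \<beta> * om" "Q = U2 * pow U om" using om *(5) by metis+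
  moreover have "pow U \<beta> \<in> rational_twords" if "U \<in> rational_twords"
    using finite_pow_rational[OF that om] by simp
  ultimately show ?thesis using that *(2,4) by blast
qed

text \<open>Keeps the recursion inside the rational words: \<open>x'\<close> and \<open>m\<close>
  are factors of \<open>x\<close>, and the root \<open>u\<close> is a prefix of
  \<open>m\<close>.\<close>

lemma rational_factors:
  assumes "W \<in> rational_twords"
  shows "W = P * Q \<Longrightarrow> P \<in> rational_twords \<and> Q \<in> rational_twords"
  using assms
proof (induction W arbitrary: P Q)
  case 1
  then show ?case using mult_eq_1_iff[of P Q] rational_twords.intros(1) by metis
next
  case (2 l)
  then show ?case using lt_eq_mult[of l P Q] rational_twords.intros(1,2) by auto
next
  case (3 U V)
  from 3(5) show ?case
  proof (cases rule: levi)
    case (1 Z)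
    then show ?thesis using 3 rational_twords.intros(3) by blast
  next
    case (2 Z)
    then show ?thesis using 3 rational_twords.intros(3) by blast
  qed
next
  case (4 U)
  show ?case
  proof (cases "Q = 1")
    case True
    then show ?thesis using 4 rational_twords.intros by (metis mult_1_right)
  next
    case False
    with 4(3) show ?thesis
    proof (cases rule: pow_om_eq_multE)
      case (1 \<beta> U1 U2)
      then show ?thesis using 4(1,2) rational_twords.intros by metis
    qed
  qed
qed

definition suffixes :: "'a tword \<Rightarrow> 'a tword set" where
  "suffixes W = {Q. \<exists>P. W = P * Q}"

text \<open>The decisive case is the iteration: after any number of dropped copies, what remains of
  \<open>pow U om\<close> is a suffix of \<open>U\<close> followed by \<open>pow U om\<close>
  again.\<close>

lemma finite_suffixes: "W \<in> rational_twords \<Longrightarrow> finite (suffixes W)"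
proof (induction W rule: rational_twords.induct)
  case 1
  have "suffixes 1 \<subseteq> {1 :: 'a tword}"
  proof
    fix Q assume "Q \<in> suffixes (1 :: 'a tword)"
    then obtain P where "1 = P * Q" by (auto simp: suffixes_def)
    then have "P * Q = 1" by simp
    then show "Q \<in> {1}" by simp
  qed
  then show ?case by (rule finite_subset) simp
next
  case (2 l)
  have "suffixes (lt l) \<subseteq> {1, lt l}" unfolding suffixes_def using lt_eq_mult by force
  then show ?case by (rule finite_subset) simp
next
  case (3 U V)
  have "suffixes (U * V) \<subseteq> suffixes V \<union> (\<lambda>Z. Z * V) ` suffixes U"
  proof
    fix Q assume "Q \<in> suffixes (U * V)"
    then obtain P where "U * V = P * Q" by (auto simp: suffixes_def)
    then show "Q \<in> suffixes V \<union> (\<lambda>Z. Z * V) ` suffixes U"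
      by (cases rule: levi) (auto simp: suffixes_def)
  qed
  then show ?case using 3 by (auto intro: finite_subset)
next
  case (4 U)
  have "suffixes (pow U om) \<subseteq> insert 1 ((\<lambda>Z. Z * pow U om) ` suffixes U)"
  proof
    fix Q assume "Q \<in> suffixes (pow U om)"
    then obtain P where P: "pow U om = P * Q" by (auto simp: suffixes_def)
    show "Q \<in> insert 1 ((\<lambda>Z. Z * pow U om) ` suffixes U)"
    proof (cases "Q = 1")
      case False
      with P show ?thesis by (cases rule: pow_om_eq_multE) (auto simp: suffixes_def)
    qed simp
  qed
  then show ?case using 4 by (auto intro: finite_subset)
qed

section \<open>Lengths of rational words\<close>

primrec omega_power :: "nat \<Rightarrow> unit tword" where
  "omega_power 0 = lt ()"
| "omega_power (Suc k) = pow (omega_power k) om"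

lemma omega_power_mono: "j \<le> k \<Longrightarrow> omega_power j \<le> omega_power k"
proof (induction rule: dec_induct)
  case (step n)
  have "omega_power n \<le> omega_power n * pow (omega_power n) om" by (rule le_mult)
  then show ?case using step by simp
qed simp

lemma rational_len_bound: "W \<in> rational_twords \<Longrightarrow> \<exists>k. len W \<le> omega_power k"
proof (induction W rule: rational_twords.induct)
  case 1
  have "len 1 = 1" by simp
  then show ?case by (metis le_mult mult_1_left)
next
  case (2 l)
  then show ?case by (metis len_lt omega_power.simps(1) order_refl)
next
  case (3 U V)
  then obtain j k where "len U \<le> omega_power j" "len V \<le> omega_power k" by blast
  then have "len U \<le> omega_power (max j k)" "len V \<le> omega_power (max j k)"
    using omega_power_mono[of j "max j k"] omega_power_mono[of k "max j k"] by auto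
  let ?o = "omega_power (max j k)"
  have "len (U * V) \<le> ?o * ?o" unfolding len_mult by (intro ordinal_mult_mono) fact+
  \<comment> \<open>Appending \<open>pow ?o om\<close> makes the two copies of \<open>?o\<close>
    vanish by absorption, so the sum is bounded by the next power of \<omega>.\<close>
  also have "\<dots> \<le> ?o * ?o * pow ?o om" by (rule le_mult)
  also have "\<dots> = omega_power (Suc (max j k))" by (simp add: mult.assoc)
  finally show ?case by blast
next
  case (4 U)
  then show ?case using ordinal_pow_mono by (metis len_pow omega_power.simps(2))
qed

subsection \<open>The factorization\<close>

lemma rational_min_suffix:
  assumes "x \<in> rational_twords" "x \<noteq> 1"
  obtains x' m where "x = x' * m" "suffix_min m" "\<forall>p q. x = p * q \<longrightarrow> q \<noteq> 1 \<longrightarrow> m \<le> q"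
    "\<forall>p q. x' = p * q \<longrightarrow> q \<noteq> 1 \<longrightarrow> m < q * m"
proof -
  let ?S = "suffixes x - {1}"
  \<comment> \<open>The lexicographic order is not well-founded in general, as \<open>b\<close>,
    \<open>ab\<close>, \<open>aab\<close> and so on descend for \<open>a < b\<close>; the minimum
    exists because the set is finite.\<close>
  have "finite ?S" using finite_suffixes[OF assms(1)] by simp
  moreover have "x \<in> ?S" using assms(2) unfolding suffixes_def by (auto intro: exI[of _ 1])
  ultimately have "Min ?S \<in> ?S" "\<forall>q\<in>?S. Min ?S \<le> q"
    using Min_in[of ?S] Min_le[of ?S] by blast+
  then obtain m where m: "m \<in> ?S" "\<forall>q\<in>?S. m \<le> q" by blast
  have min: "m \<le> q" if "x = p * q" "q \<noteq> 1" for p q using m(2) that by (auto simp: suffixes_def)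
  let ?T = "{p. x = p * m}"
  obtain p where "p \<in> ?T" using m(1) by (auto simp: suffixes_def)
  then obtain x' where x': "x' \<in> ?T" "\<forall>p. (p, x') \<in> strict_prefix_rel \<longrightarrow> p \<notin> ?T"
    using wfE_min[OF wf_strict_prefix_rel, of p ?T] by metis
  have "suffix_min m"
    unfolding suffix_min_def
  proof (intro conjI allI impI)
    fix p q assume "m = p * q" "q \<noteq> 1"
    then show "m \<le> q" using min[of "x' * p" q] x'(1) by (simp add: mult.assoc)
  qed (use m in simp)
  moreover have "m < q * m" if "x' = p * q" "q \<noteq> 1" for p q
  proof -
    have x: "x = p * (q * m)" using x'(1) that by (simp add: mult.assoc)
    then have "m \<le> q * m" using min that by simp
    \<comment> \<open>Equality would make the proper prefix \<open>p\<close> of \<open>x'\<close> a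
      shorter choice, since then \<open>x = p * m\<close>.\<close>
    moreover have "m \<noteq> q * m"
    proof
      assume "m = q * m"
      then have "p \<in> ?T" using x by simp
      moreover have "(p, x') \<in> strict_prefix_rel" using that by (auto simp: strict_prefix_rel_def)
      ultimately show False using x'(2) by blast
    qed
    ultimately show ?thesis by simp
  qed
  ultimately show ?thesis using that x'(1) min by blast
qed

definition pow_prod :: "('a tword \<times> unit tword) list \<Rightarrow> 'a tword" where
  "pow_prod fs = prod_list (map (\<lambda>(u, \<alpha>). pow u \<alpha>) fs)"

lemma pow_prod_simps [simp]:
  "pow_prod [] = 1" "pow_prod ((u, \<alpha>) # fs) = pow u \<alpha> * pow_prod fs"
  "pow_prod (fs @ gs) = pow_prod fs * pow_prod gs"
  by (simp_all add: pow_prod_def)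

text \<open>The last base \<open>u\<close> and the least suffix \<open>m\<close> are exposed because
  the next base is compared with them. The last exponent may exceed the one that yields
  \<open>m\<close>, since equal bases are merged.\<close>

lemma rational_factorization:
  fixes x :: "'a::linorder tword"
  assumes "x \<in> rational_twords" "x \<noteq> 1"
  shows "\<exists>fs u \<alpha> m. x = pow_prod (fs @ [(u, \<alpha>)]) \<and>
    successively (\<lambda>p q. fst q < fst p) (fs @ [(u, \<alpha>)]) \<and>
    (\<forall>(v, \<beta>)\<in>set (fs @ [(u, \<alpha>)]). v \<in> rational_twords \<and> prime_tword v) \<and>
    shortest_root u m \<and> m \<noteq> 1 \<and> (\<exists>p. x = p * m) \<and> (\<forall>p q. x = p * q \<longrightarrow> q \<noteq> 1 \<longrightarrow> m \<le> q)"
  using assms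
proof (induction x rule: wf_induct_rule[OF wf_strict_prefix_rel])
  case (1 x)
  obtain x' m where m: "x = x' * m" "suffix_min m" "\<forall>p q. x = p * q \<longrightarrow> q \<noteq> 1 \<longrightarrow> m \<le> q"
    "\<forall>p q. x' = p * q \<longrightarrow> q \<noteq> 1 \<longrightarrow> m < q * m"
    using 1(2,3) by (rule rational_min_suffix)
  have m1: "m \<noteq> 1" using m(2) by (simp add: suffix_min_def)
  obtain u where root: "shortest_root u m" by (rule shortest_root_exists)
  then have prime: "prime_tword u" using shortest_root_prime m(2) by blast
  obtain \<alpha> where \<alpha>: "m = pow u \<alpha>" using root by (auto simp: shortest_root_def)
  have rat: "x' \<in> rational_twords" "m \<in> rational_twords" using rational_factors[OF 1(2) m(1)] by auto
  obtain r where "m = u * r" using \<alpha> m1 not_1_pow by (metis pow_1_right)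
  then have u: "u \<in> rational_twords" using rational_factors rat(2) by blast
  note last = root m1 m(1,3)
  show ?case
  proof (cases "x' = 1")
    case True
    then have "x = pow_prod ([] @ [(u, \<alpha>)])" using m(1) \<alpha> by simp
    moreover have "successively (\<lambda>p q. fst q < fst p) ([] @ [(u, \<alpha>)])" by simp
    moreover have "\<forall>(v, \<beta>)\<in>set ([] @ [(u, \<alpha>)]). v \<in> rational_twords \<and> prime_tword v"
      using u prime by simp
    ultimately show ?thesis using last by blast
  next
    case False
    have "(x', x) \<in> strict_prefix_rel" using m(1) m1 by (auto simp: strict_prefix_rel_def)
    from 1(1)[OF this rat(1) False] obtain fs u' \<alpha>' m' where
      fs: "x' = pow_prod (fs @ [(u', \<alpha>')])" "successively (\<lambda>p q. fst q < fst p) (fs @ [(u', \<alpha>')])"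
        "\<forall>(v, \<beta>)\<in>set (fs @ [(u', \<alpha>')]). v \<in> rational_twords \<and> prime_tword v"
      and m': "shortest_root u' m'" "m' \<noteq> 1" "\<exists>p. x' = p * m'"
      by blast
    obtain p where p: "x' = p * m'" using m'(3) by blast
    have less: "m < m' * m" using m(4) p m'(2) by blast
    have "m \<le> m'"
    proof (rule ccontr)
      assume "\<not> m \<le> m'"
      then have "m' \<le> m" "m' \<noteq> m" by auto
      then consider "strict_less m' m" | t where "m = m' * t" "t \<noteq> 1" by (rule le_neqE)
      then show False
      proof cases
        case 1
        then have "m' * m < m" using strict_less_mult[of m' m m 1] strict_less_imp_less by auto
        then show False using less by simp
      next
        case (2 t)
        \<comment> \<open>As a suffix of \<open>x\<close>, \<open>t\<close> is at least
          \<open>m\<close>; putting \<open>m'\<close> in front of both gives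
          \<open>m' * m \<le> m' * t = m\<close>.\<close>
        have "x = (x' * m') * t" using m(1) 2 by (simp add: mult.assoc)
        then have "m \<le> t" using m(3) 2 by blast
        then have "m' * m \<le> m" using 2 by simp
        then show False using less by simp
      qed
    qed
    moreover obtain \<beta> where "m' = pow u' \<beta>" using m'(1) by (auto simp: shortest_root_def)
    ultimately have "u \<le> u'" using shortest_root_mono[OF m(2) root] m'(2) by blast
    then consider "u = u'" | "u < u'" by fastforce
    then show ?thesis
    proof cases
      case 1
      have "x = pow_prod (fs @ [(u, \<alpha>' * \<alpha>)])"
        using m(1) fs(1) \<alpha> 1 by (simp add: pow_mult mult.assoc)
      moreover have "successively (\<lambda>p q. fst q < fst p) (fs @ [(u, \<alpha>' * \<alpha>)])"
        using fs(2) 1 by (auto simp: successively_append_iff)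
      moreover have "\<forall>(v, \<beta>)\<in>set (fs @ [(u, \<alpha>' * \<alpha>)]). v \<in> rational_twords \<and> prime_tword v"
        using fs(3) u prime by auto
      ultimately show ?thesis using last by blast
    next
      case 2
      have "x = pow_prod ((fs @ [(u', \<alpha>')]) @ [(u, \<alpha>)])"
        using m(1) fs(1) \<alpha> by (simp add: mult.assoc)
      moreover have "successively (\<lambda>p q. fst q < fst p) ((fs @ [(u', \<alpha>')]) @ [(u, \<alpha>)])"
        using fs(2) 2 by (subst successively_append_iff) simp
      moreover have "\<forall>(v, \<beta>)\<in>set ((fs @ [(u', \<alpha>')]) @ [(u, \<alpha>)]). v \<in> rational_twords \<and> prime_tword v"
        using fs(3) u prime by auto
      ultimately show ?thesis using last by blast
    qed
  qed
qed

text \<open>A nonempty base has length at least one, so \<alpha> is at most the length of its own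
  factor.\<close>

lemma exponent_le_len:
  assumes "(u, \<alpha>) \<in> set fs" "u \<noteq> 1"
  shows "\<alpha> \<le> len (pow_prod fs)"
proof -
  obtain gs hs where "fs = gs @ (u, \<alpha>) # hs" using assms(1) split_list by metis
  then have eq: "len (pow_prod fs) = len (pow_prod gs) * (pow (len u) \<alpha> * len (pow_prod hs))"
    by simp
  have "lt () \<le> len u" using assms(2) ordinal_not_1[of "len u"] by simp
  then have "\<alpha> \<le> pow (len u) \<alpha>" using ordinal_pow_mono[of "lt ()" "len u" \<alpha>] by simp
  also have "\<dots> \<le> pow (len u) \<alpha> * len (pow_prod hs)" by simp
  also have "\<dots> \<le> len (pow_prod fs)" unfolding eq by simp
  finally show ?thesis .
qed

subsection \<open>Ordinals below omega to the omega\<close>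

text \<open>The map \<open>f\<close> need not reach an initial segment. If \<open>r\<close> embedded
  into \<open>s\<close> by \<open>g\<close>, the strictly monotone self-map \<open>f\<close> after
  \<open>g\<close> of \<open>r\<close> would move \<open>B\<close> down; the least point moved down
  is sent to a smaller one that is moved down as well.\<close>

lemma ordLess_if_bounded_strict_mono:
  assumes s: "Well_order s" and r: "Well_order r"
    and mono: "\<And>a b. (a, b) \<in> s \<Longrightarrow> a \<noteq> b \<Longrightarrow> (f a, f b) \<in> r \<and> f a \<noteq> f b"
    and B: "B \<in> Field r" "\<And>a. a \<in> Field s \<Longrightarrow> (f a, B) \<in> r \<and> f a \<noteq> B"
  shows "(s, r) \<in> ordLess"
proof (rule ccontr)
  assume "(s, r) \<notin> ordLess"
  then have "(r, s) \<in> ordLeq" using ordLess_or_ordLeq[OF s r] by blast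
  then obtain g where g: "embed r s g" by (auto simp: ordLeq_def)
  have g_inj: "inj_on g (Field r)" by (rule embed_inj_on[OF r g])
  have g_mono: "(g a, g b) \<in> s" if "(a, b) \<in> r" for a b
    using embed_compat[OF g] that by (auto simp: compat_def)
  have g_Field: "g a \<in> Field s" if "a \<in> Field r" for a
    using embed_Field[OF g] that by blast
  let ?D = "{x \<in> Field r. (f (g x), x) \<in> r \<and> f (g x) \<noteq> x}"
  have "B \<in> ?D" using B g_Field by blast
  then obtain x where x: "x \<in> ?D" "\<forall>y\<in>?D. (x, y) \<in> r"
    using Well_order_least[OF r, of ?D] by blast
  let ?y = "f (g x)"
  have y: "?y \<in> Field r" using x(1) by (auto intro: FieldI1)
  moreover have "(f (g ?y), ?y) \<in> r \<and> f (g ?y) \<noteq> ?y"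
  proof (rule mono)
    show "(g ?y, g x) \<in> s" using g_mono x(1) by blast
    show "g ?y \<noteq> g x" using inj_onD[OF g_inj _ y, of x] x(1) by auto
  qed
  ultimately have "(x, ?y) \<in> r" using x(2) by blast
  then show False using x(1) Well_order_facts(2)[OF r] by blast
qed

lemma lex_less_than_total:
  "length xs = length ys \<Longrightarrow> xs = ys \<or> (xs, ys) \<in> lex less_than \<or> (ys, xs) \<in> lex less_than"
  by (induction xs ys rule: list_induct2) (auto simp: Cons_in_lex)

lemma lex_less_than_irrefl: "(xs, xs) \<notin> lex less_than"
  by (induction xs) (auto simp: Cons_in_lex)

lemma Field_omega_pow: "Field (omega_pow k) = {xs. length xs = k}"
  by (auto simp: omega_pow_def Field_def)

lemma Well_order_omega_pow: "Well_order (omega_pow k)"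
proof (rule Well_orderI)
  have "wf (lex less_than :: (nat list \<times> nat list) set)" by (rule wf_lex) simp
  note wf = this
  show "antisym (omega_pow k)"
    using wf_not_sym[OF wf] by (auto simp: antisym_def omega_pow_def)
  fix A assume A: "A \<subseteq> Field (omega_pow k)" "A \<noteq> {}"
  then obtain x where x: "x \<in> A" "\<And>y. (y, x) \<in> lex less_than \<Longrightarrow> y \<notin> A"
    using wf unfolding wf_eq_minimal by (metis all_not_in_conv)
  have len: "length y = k" if "y \<in> A" for y using that A(1) by (auto simp: Field_omega_pow)
  have "(x, y) \<in> omega_pow k" if "y \<in> A" for y
    using x(2)[of y] that len[OF that] len[OF x(1)] lex_less_than_total[of x y]
    by (auto simp: omega_pow_def)
  then show "\<exists>a\<in>A. \<forall>b\<in>A. (a, b) \<in> omega_pow k" using x(1) by blast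
qed

text \<open>A strictly monotone map to lists is asked for instead of an embedding onto an initial
  segment: it extends to the next power by adding a head, and it still bounds the order
  type.\<close>

definition maps_into_omega_pow :: "nat \<Rightarrow> 'a word \<Rightarrow> bool" where
  "maps_into_omega_pow k x \<longleftrightarrow> (\<exists>f. (\<forall>a\<in>Field (fst x). length (f a) = k) \<and>
     (\<forall>a b. (a, b) \<in> fst x \<longrightarrow> a \<noteq> b \<longrightarrow> (f a, f b) \<in> lex less_than))"

lemma maps_into_omega_pow_cong:
  assumes "maps_into_omega_pow k y" "word_eq x y"
  shows "maps_into_omega_pow k x"
proof -
  obtain f where f: "\<forall>a\<in>Field (fst y). length (f a) = k"
     "\<forall>a b. (a, b) \<in> fst y \<longrightarrow> a \<noteq> b \<longrightarrow> (f a, f b) \<in> lex less_than"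
    using assms(1) by (auto simp: maps_into_omega_pow_def)
  obtain h where "word_iso h x y" using assms(2) word_eq_iff_iso by blast
  note h = word_isoD[OF this]
  show ?thesis
    unfolding maps_into_omega_pow_def
  proof (intro exI[of _ "f \<circ> h"] conjI ballI allI impI)
    fix a assume "a \<in> Field (fst x)"
    then show "length ((f \<circ> h) a) = k" using f(1) h(4) by auto
  next
    fix a b assume ab: "(a, b) \<in> fst x" "a \<noteq> b"
    then have F: "a \<in> Field (fst x)" "b \<in> Field (fst x)" by (auto intro: FieldI1 FieldI2)
    then have "(h a, h b) \<in> fst y" "h a \<noteq> h b" using h(5) ab inj_onD[OF h(3)] by blast+
    then show "((f \<circ> h) a, (f \<circ> h) b) \<in> lex less_than" using f(2) by simp
  qed
qed

lemma maps_into_omega_pow_rep: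
  "wf_word x \<Longrightarrow> maps_into_omega_pow k (rep (cls x)) \<longleftrightarrow> maps_into_omega_pow k x"
  using maps_into_omega_pow_cong rep_cls word_eq_sym by blast

lemma maps_into_omega_pow_omega_power: "maps_into_omega_pow k (rep (omega_power k))"
proof (induction k)
  case 0
  have "maps_into_omega_pow 0 (letter ())"
    unfolding maps_into_omega_pow_def by (auto intro!: exI[of _ "\<lambda>_. []"] simp: letter_def)
  then have "maps_into_omega_pow 0 (rep (cls (letter ())))" by (simp add: maps_into_omega_pow_rep)
  then show ?case by (simp add: cls_letter)
next
  case (Suc k)
  let ?w = "rep (omega_power k)" and ?o = "(omega_ord, \<lambda>_. ()) :: unit word"
  obtain f where f: "\<forall>a\<in>Field (fst ?w). length (f a) = k"
     "\<forall>a b. (a, b) \<in> fst ?w \<longrightarrow> a \<noteq> b \<longrightarrow> (f a, f b) \<in> lex less_than"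
    using Suc by (auto simp: maps_into_omega_pow_def)
  have "maps_into_omega_pow (Suc k) (word_pow ?w (fst ?o))"
    unfolding maps_into_omega_pow_def
  \<comment> \<open>The index of the copy becomes the head of the list, the most significant
    coordinate.\<close>
  proof (intro exI[of _ "\<lambda>n. case prod_decode n of (b, a) \<Rightarrow> b # f a"] conjI ballI allI impI)
    fix n assume "n \<in> Field (fst (word_pow ?w (fst ?o)))"
    then show "length (case prod_decode n of (b, a) \<Rightarrow> b # f a) = Suc k"
      using f(1) by (cases n rule: prod_encode_cases) auto
  next
    fix m n assume "(m, n) \<in> fst (word_pow ?w (fst ?o))" "m \<noteq> n"
    then show "(case prod_decode m of (b, a) \<Rightarrow> b # f a, case prod_decode n of (b, a) \<Rightarrow> b # f a)
        \<in> lex less_than"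
      using f
      by (cases m rule: prod_encode_cases; cases n rule: prod_encode_cases)
        (auto simp: Cons_in_lex)
  qed
  then have "maps_into_omega_pow (Suc k) (rep (cls (word_pow ?w (fst ?o))))"
    using Well_order_omega_ord by (subst maps_into_omega_pow_rep) (auto simp del: Field_omega_ord)
  then show ?case by (simp only: cls_pow[OF wf_rep wf_om] cls_rep omega_power.simps)
qed

lemma below_omega_omega_rep:
  assumes "\<alpha> \<le> omega_power k"
  shows "below_omega_omega (fst (rep \<alpha>))"
  unfolding below_omega_omega_def
proof (intro conjI exI[of _ "Suc k"])
  obtain \<gamma> where \<gamma>: "omega_power k = \<alpha> * \<gamma>" using assms by (auto simp: ordinal_le_iff)
  let ?c = "concat_word (rep \<alpha>) (rep \<gamma>)"
  have "omega_power k = cls ?c" using \<gamma> by (simp add: cls_mult)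
  then have "maps_into_omega_pow k ?c"
    using maps_into_omega_pow_omega_power[of k] maps_into_omega_pow_rep[of ?c] by simp
  then obtain f where f: "\<forall>a\<in>Field (fst ?c). length (f a) = k"
     "\<forall>a b. (a, b) \<in> fst ?c \<longrightarrow> a \<noteq> b \<longrightarrow> (f a, f b) \<in> lex less_than"
    by (auto simp: maps_into_omega_pow_def)
  \<comment> \<open>The additional leading coordinate makes the bound strict: all images begin with
    0 and lie below the list 1, 0, ..., 0. The doubled positions are those of \<alpha> inside
    \<open>?c\<close>.\<close>
  show "(fst (rep \<alpha>), omega_pow (Suc k)) \<in> ordLess"
  proof (rule ordLess_if_bounded_strict_mono)
    fix a b assume ab: "(a, b) \<in> fst (rep \<alpha>)" "a \<noteq> b"
    then have F: "a \<in> Field (fst (rep \<alpha>))" "b \<in> Field (fst (rep \<alpha>))" by (auto intro: FieldI1 FieldI2)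
    have "(f (2 * a), f (2 * b)) \<in> lex less_than" using f(2) ab by simp
    then show "(0 # f (2 * a), 0 # f (2 * b)) \<in> omega_pow (Suc k) \<and> 0 # f (2 * a) \<noteq> 0 # f (2 * b)"
      using f(1) F lex_less_than_irrefl by (auto simp: omega_pow_def Cons_in_lex)
  next
    fix a assume "a \<in> Field (fst (rep \<alpha>))"
    then show "(0 # f (2 * a), 1 # replicate k 0) \<in> omega_pow (Suc k) \<and> 0 # f (2 * a) \<noteq> 1 # replicate k 0"
      using f(1) by (auto simp: omega_pow_def Cons_in_lex)
  next
    show "Well_order (omega_pow (Suc k))" by (rule Well_order_omega_pow)
  qed (simp_all add: Field_omega_pow)
qed simp

subsection \<open>Transfer to representatives\<close>

lemma cls_rat_words: "y \<in> rat_words \<Longrightarrow> wf_word y \<and> cls y \<in> rational_twords"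
proof (induction y rule: rat_words.induct)
  case 1
  then show ?case using rational_twords.intros(1) by (simp flip: one_tword.abs_eq)
next
  case (4 u)
  have "omega_iter u = word_pow u (fst (omega_ord, \<lambda>_. ()))" by (simp add: omega_iter_def)
  then show ?case
    using 4 Well_order_omega_ord cls_pow[of u "(omega_ord, \<lambda>_. ())"] rational_twords.intros(4)
    by (metis fst_conv wf_om wf_word_pow)
qed (auto simp: cls_letter cls_mult intro: rational_twords.intros)

lemma rational_imp_cls: "rational x \<Longrightarrow> wf_word x \<and> cls x \<in> rational_twords"
  unfolding rational_def using cls_rat_words cls_eq_iff word_eqD by metis

lemma rational_rep:
  assumes "U \<in> rational_twords" shows "rational (rep U)"
proof -
  have "\<exists>y\<in>rat_words. wf_word y \<and> U = cls y"
    using assms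
  proof (induction U)
    case 1
    then show ?case
      using rat_words.intros(1) by (intro bexI[of _ empty_word]) (simp_all add: one_tword.abs_eq)
  next
    case (2 l)
    then show ?case using rat_words.intros(2) cls_letter wf_letter by metis
  next
    case (3 U V)
    then show ?case using rat_words.intros(3) cls_mult wf_concat_word by metis
  next
    case (4 U)
    then obtain y where y: "y \<in> rat_words" "wf_word y" "U = cls y" by blast
    have "pow U om = cls (omega_iter y)"
      using cls_pow[OF y(2) wf_om] y(3) by (simp add: omega_iter_def)
    then show ?case using rat_words.intros(4)[OF y(1)] cls_rat_words by blast
  qed
  then show ?thesis unfolding rational_def using cls_eq_iff[of "rep U"] by auto
qed

lemma lex_leI:
  assumes "wf_word x" "wf_word y" "cls x \<le> cls y"
  shows "lex_le x y"
proof -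
  have eq: "word_eq z (concat_word (rep P) (concat_word (letter l) (rep Z)))"
    if "wf_word z" "cls z = P * (lt l * Z)" for z P l Z
    using that by (subst cls_eq_iff[symmetric]) (auto simp: cls_mult cls_letter)
  from assms(3) consider "is_prefix (cls x) (cls y)" | "strict_less (cls x) (cls y)"
    by (auto simp: less_eq_tword_def)
  then show ?thesis
  proof cases
    case 1
    then obtain Z where "cls y = cls x * Z" by (auto simp: is_prefix_def)
    then have "word_eq (concat_word x (rep Z)) y"
      using assms by (simp add: cls_mult flip: cls_eq_iff)
    then have "prefix_word x y" unfolding prefix_word_def using wf_rep by blast
    then show ?thesis by (simp add: lex_le_def)
  next
    case 2
    then obtain P l l' Z Z' where *: "l < l'" "cls x = P * (lt l * Z)" "cls y = P * (lt l' * Z')"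
      unfolding strict_less_def by blast
    have "str_less x y"
      unfolding str_less_def
      using *(1) eq[OF assms(1) *(2)] eq[OF assms(2) *(3)] wf_rep[of P] wf_rep[of Z] wf_rep[of Z']
      by blast
    then show ?thesis by (simp add: lex_le_def)
  qed
qed

lemma lex_less_rep: "U < V \<Longrightarrow> lex_less (rep U) (rep V)"
  using lex_leI[of "rep U" "rep V"] cls_eq_iff[of "rep U" "rep V"] by (auto simp: lex_less_def)

lemma prime_word_rep:
  assumes "prime_tword U" shows "prime_word (rep U)"
  unfolding prime_word_def primitive_def
proof (intro conjI allI impI; (elim conjE)?)
  fix y and s :: "nat rel"
  assume y: "wf_word y" "Well_order s" "word_eq (rep U) (word_pow y s)"
  let ?s = "(s, \<lambda>_. ()) :: unit word"
  have s: "wf_word ?s" using y(2) by (simp add: wf_word_def)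
  have "cls (rep U) = cls (word_pow y (fst ?s))" using y by (subst cls_eq_iff) auto
  then have "U = pow (cls y) (cls ?s)" by (simp only: cls_pow[OF y(1) s] cls_rep)
  then have *: "cls ?s = lt ()" "cls y = U" using assms by (auto simp: prime_tword_def)
  have "word_eq ?s (letter ())" using *(1) s by (simp flip: cls_letter add: cls_eq_iff)
  then obtain h :: "nat \<Rightarrow> nat" where "bij_betw h (Field s) {0}" by (auto simp: word_eq_iff_iso word_iso_def)
  then show "card (Field s) = 1" by (metis bij_betw_same_card card.empty card_insert_disjoint empty_iff finite.emptyI One_nat_def)
  show "word_eq y (rep U)" using *(2) y(1) cls_eq_iff[of y "rep U"] by simp
next
  fix y z assume yz: "wf_word y" "wf_word z" "fst y \<noteq> {}" "fst z \<noteq> {}" "word_eq (rep U) (concat_word y z)"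
  have "U = cls y * cls z"
    using yz cls_eq_iff[of "rep U" "concat_word y z"] by (simp add: cls_mult)
  moreover have "cls y \<noteq> 1" "cls z \<noteq> 1" using yz by (auto simp: cls_eq_1_iff Field_def)
  ultimately have "U \<le> cls z" using assms unfolding prime_tword_def by blast
  then show "lex_le (rep U) z" using lex_leI[of "rep U" z] yz(2) by simp
qed simp

lemma cls_foldr_concat_word:
  fixes fs :: "('a tword \<times> unit tword) list"
  defines "w \<equiv> foldr (\<lambda>(u, \<alpha>) w. concat_word (word_pow u \<alpha>) w)
    (map (\<lambda>(u, \<alpha>). (rep u, fst (rep \<alpha>))) fs) empty_word"
  shows "wf_word w \<and> cls w = pow_prod fs"
  unfolding w_def
proof (induction fs)
  case Nil
  then show ?case by (simp add: one_tword.abs_eq)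
next
  case (Cons f fs)
  then show ?case by (cases f) (simp add: cls_mult cls_pow)
qed

theorem mainTheorem2:
  fixes x :: "'a::{linorder,finite} word"
  assumes "rational x"
  shows "\<exists>ps :: ('a word \<times> nat rel) list.
           (\<forall>(u, \<alpha>) \<in> set ps. rational u \<and> prime_word u \<and> below_omega_omega \<alpha>) \<and>
           successively (\<lambda>p q. lex_less (fst q) (fst p)) ps \<and>
           word_eq x (foldr (\<lambda>(u, \<alpha>) w. concat_word (word_pow u \<alpha>) w) ps empty_word)"
proof -
  have x: "wf_word x" "cls x \<in> rational_twords" using rational_imp_cls[OF assms] by auto
  obtain fs where fs: "cls x = pow_prod fs" "successively (\<lambda>p q. fst q < fst p) fs"
    "\<forall>(v, \<beta>)\<in>set fs. v \<in> rational_twords \<and> prime_tword v"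
  proof (cases "cls x = 1")
    case True
    then show ?thesis using that[of "[]"] by simp
  next
    case False
    then show ?thesis using rational_factorization[OF x(2)] that by blast
  qed
  \<comment> \<open>One \<open>k\<close> serves all factors, as every exponent is at most the length
    of \<open>x\<close>.\<close>
  obtain k where k: "len (cls x) \<le> omega_power k" using rational_len_bound[OF x(2)] by blast
  let ?ps = "map (\<lambda>(u, \<alpha>). (rep u, fst (rep \<alpha>))) fs"
  have "rational (rep u) \<and> prime_word (rep u) \<and> below_omega_omega (fst (rep \<alpha>))"
    if "(u, \<alpha>) \<in> set fs" for u \<alpha>
  proof -
    have u: "u \<in> rational_twords" "prime_tword u" using fs(3) that by auto
    have "\<alpha> \<le> len (cls x)" unfolding fs(1)
      using that prime_tword_neq_1[OF u(2)] by (rule exponent_le_len)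
    then have "below_omega_omega (fst (rep \<alpha>))"
      using k by (intro below_omega_omega_rep[of _ k]) (rule order_trans)
    then show ?thesis using rational_rep prime_word_rep u by blast
  qed
  then have "\<forall>(u, \<alpha>) \<in> set ?ps. rational u \<and> prime_word u \<and> below_omega_omega \<alpha>" by auto
  moreover have "successively (\<lambda>p q. lex_less (fst q) (fst p)) ?ps"
    unfolding successively_map using fs(2)
    by (rule successively_mono) (auto simp: lex_less_rep split: prod.splits)
  moreover have "word_eq x (foldr (\<lambda>(u, \<alpha>) w. concat_word (word_pow u \<alpha>) w) ?ps empty_word)"
    using cls_foldr_concat_word[of fs] fs(1) by (subst cls_eq_iff[OF x(1), symmetric]) simp_all
  ultimately show ?thesis by blast
qed

end
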